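(* Let $N\ge2$, $\Omega=\mathbb{R}^{N-1}\times(0,\infty)$, $(\phi,\psi)\in L^\infty(\Omega)\times L^\infty(\partial\Omega)$, and fix $\epsilon>0$, $k>0$. With $u^\delta_k$, $u^\delta_0$, $w_\epsilon$, $U$, $z^D_\epsilon$ as in the context, for every $L>0$, $T>0$, \[\sup_{(x,t)\in\Omega_L^c\times(0,T)}|u^\delta_k(x,t)-w_\epsilon(x,t)|=O(\delta^{-1}),\qquad\sup_{(x,t)\in\Omega_L^c\times(0,T)}|u^\delta_0(x,t)-w_\epsilon(x,t)|=O(\delta^{-1})\quad\text{as }\delta\to\infty.\] Moreover: (1) for every $L>0$, $T>0$, $\sup_{(x,t)\in\Omega_L\times[T,\infty)}|w_\epsilon(x,t)-U(x)|=O(\epsilon^{1/2})$ as $\epsilon\to0^+$; (2) if $(\phi,\psi)\in BC(\Omega)\times L^\infty(\partial\Omega)$, then for every compact $K\subset\Omega$ and $T>0$, $\lim_{\epsilon\to\infty}\sup_{(x,t)\in K\times(0,T)}|w_\epsilon(x,t)-\phi(x)|=0$.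
   Context: $x=(x',x_N)$, $\partial\Omega\cong\mathbb{R}^{N-1}$ with surface measure $d\sigma$, $\Delta'$ the Laplacian in $x'$. $\Gamma_d(x,t)=(4\pi t)^{-d/2}e^{-|x|^2/(4t)}$, $\partial_\xi\Gamma_1$ the spatial derivative of $\Gamma_1$, $y^*=(y',-y_N)$, $G_0(x,y,s)=\Gamma_N(x-y,s)-\Gamma_N(x-y^*,s)$. $P(x)=c_Nx_N|x|^{-N}$, $c_N=\pi^{-N/2}\Gamma(N/2)$. $\Omega_L=\{x\in\overline\Omega:0\le x_N\le L\}$, $\Omega^c_L=\{x\in\overline\Omega:x_N>L\}$. For $\kappa\ge0$, $\delta>0$: $H(x,y,t)=-2\int_0^t\Gamma_{N-1}(x'-y',\frac{t-\tau}\epsilon+\frac\kappa\delta\tau)\partial_\xi\Gamma_1(x_N+y_N+\frac\tau\delta,\frac{t-\tau}\epsilon)d\tau$, $G=G_0(x,y,t/\epsilon)+\delta^{-1}H$, and $u^\delta_\kappa(x,t)=\int_\Omega G(x,y,t)\phi(y)dy+\frac\delta\epsilon\int_{\partial\Omega}G(x,y,t)\psi(y)d\sigma(y)$ (solution of $\epsilon\partial_tu=\Delta u$ in $\Omega$, $\delta\partial_tu-\kappa\Delta'u-\partial_{x_N}u=0$ on $\partial\Omega$, initial data $(\phi,\psi)$). $w_\epsilon(x,t)=\int_\Omega G_0(x,y,t/\epsilon)\phi(y)dy-\frac2\epsilon\int_0^t\int_{\partial\Omega}\Gamma_{N-1}(x'-y',\frac{t-\tau}\epsilon)\partial_\xi\Gamma_1(x_N,\frac{t-\tau}\epsilon)\psi(y)d\sigma(y)d\tau$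 (solution of $\epsilon\partial_tu=\Delta u$ in $\Omega$, $u=\psi$ on $\partial\Omega$, $u(0)=\phi$). $U(x)=\int_{\partial\Omega}P(x'-y',x_N)\psi(y)d\sigma(y)$. *)

theory Defs
  imports "HOL-Analysis.Analysis"
begin

text \<open>Points of the closed half space are pairs (x', x_N) with x' in an arbitrary
Euclidean space 'a of dimension N-1 (so N = DIM('a)+1 >= 2).\<close>

definition Omega :: "('a::euclidean_space \<times> real) set" where
  "Omega = UNIV \<times> {0<..}"

definition Omega_L :: "real \<Rightarrow> ('a::euclidean_space \<times> real) set" where
  "Omega_L L = UNIV \<times> {0..L}"

definition Omega_Lc :: "real \<Rightarrow> ('a::euclidean_space \<times> real) set" where
  "Omega_Lc L = UNIV \<times> {L<..}"

text \<open>Gaussian kernel Gamma_d(x,s) as a function of r = |x|.\<close>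
definition Gam :: "nat \<Rightarrow> real \<Rightarrow> real \<Rightarrow> real" where
  "Gam d r s = (4 * pi * s) powr (- real d / 2) * exp (- (r\<^sup>2) / (4 * s))"

definition dGam1 :: "real \<Rightarrow> real \<Rightarrow> real" where
  "dGam1 \<xi> s = - (\<xi> / (2 * s)) * Gam 1 \<xi> s"

definition refl :: "'a::euclidean_space \<times> real \<Rightarrow> 'a \<times> real" where
  "refl y = (fst y, - snd y)"

definition G0 :: "('a::euclidean_space \<times> real) \<Rightarrow> ('a \<times> real) \<Rightarrow> real \<Rightarrow> real" where
  "G0 x y s = Gam (DIM('a) + 1) (norm (x - y)) s - Gam (DIM('a) + 1) (norm (x - refl y)) s"

definition Hk :: "real \<Rightarrow> real \<Rightarrow> real \<Rightarrow> ('a::euclidean_space \<times> real) \<Rightarrow> ('a \<times> real) \<Rightarrow> real \<Rightarrow> real" where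
  "Hk \<epsilon> \<kappa> \<delta> x y t = - 2 * (LBINT \<tau>=0..t.
      Gam DIM('a) (norm (fst x - fst y)) ((t - \<tau>) / \<epsilon> + \<kappa> / \<delta> * \<tau>)
      * dGam1 (snd x + snd y + \<tau> / \<delta>) ((t - \<tau>) / \<epsilon>))"

definition Gk :: "real \<Rightarrow> real \<Rightarrow> real \<Rightarrow> ('a::euclidean_space \<times> real) \<Rightarrow> ('a \<times> real) \<Rightarrow> real \<Rightarrow> real" where
  "Gk \<epsilon> \<kappa> \<delta> x y t = G0 x y (t / \<epsilon>) + Hk \<epsilon> \<kappa> \<delta> x y t / \<delta>"

text \<open>Solution u^delta_kappa of the dynamic boundary problem.\<close>
definition u_dyn :: "real \<Rightarrow> real \<Rightarrow> real \<Rightarrow> ('a::euclidean_space \<times> real \<Rightarrow> real) \<Rightarrow> ('a \<Rightarrow> real)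
    \<Rightarrow> ('a \<times> real) \<Rightarrow> real \<Rightarrow> real" where
  "u_dyn \<epsilon> \<kappa> \<delta> \<phi> \<psi> x t =
     (LINT y:Omega|lborel. Gk \<epsilon> \<kappa> \<delta> x y t * \<phi> y)
     + \<delta> / \<epsilon> * (LINT y'|lborel. Gk \<epsilon> \<kappa> \<delta> x (y', 0) t * \<psi> y')"

text \<open>Solution w_epsilon of the Dirichlet problem.\<close>
definition w_dir :: "real \<Rightarrow> ('a::euclidean_space \<times> real \<Rightarrow> real) \<Rightarrow> ('a \<Rightarrow> real)
    \<Rightarrow> ('a \<times> real) \<Rightarrow> real \<Rightarrow> real" where
  "w_dir \<epsilon> \<phi> \<psi> x t =
     (LINT y:Omega|lborel. G0 x y (t / \<epsilon>) * \<phi> y)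
     - 2 / \<epsilon> * (LBINT \<tau>=0..t. (LINT y'|lborel.
          Gam DIM('a) (norm (fst x - y')) ((t - \<tau>) / \<epsilon>)
          * dGam1 (snd x) ((t - \<tau>) / \<epsilon>) * \<psi> y'))"

definition Pker :: "'a::euclidean_space \<Rightarrow> real \<Rightarrow> real" where
  "Pker x' xN = (let N = real (DIM('a) + 1) in
      pi powr (- N / 2) * Gamma (N / 2) * xN * norm (x', xN) powr (- N))"

definition U_harm :: "('a::euclidean_space \<Rightarrow> real) \<Rightarrow> ('a \<times> real) \<Rightarrow> real" where
  "U_harm \<psi> x = (LINT y'|lborel. Pker (fst x - y') (snd x) * \<psi> y')"

end

theory Submission
  imports Defs "HOL-Probability.Distributions"
begin

text \<open>
Integrating \<open>\<psi>\<close> against the tangential kernel gives the heat semigroup \<open>heat \<psi>\<close> on the boundary.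
After Fubini, both solutions have boundary terms of the form
\<open>\<integral>\<^sub>0\<^sup>t heat \<psi> x' (\<dots>) dGam1 (\<dots>) d\<tau>\<close>, and passing from the Dirichlet to the dynamic problem shifts the
arguments by \<open>\<kappa>\<tau>/\<delta>\<close> and \<open>\<tau>/\<delta>\<close>. Away from the boundary \<open>dGam1\<close> is Lipschitz and bounded by a multiple
of \<open>s = (t - \<tau>)/\<epsilon>\<close>; the latter compensates the factor \<open>1/s\<close> in the \<open>L\<^sup>1\<close> modulus of the heat kernel in
time. Hence the difference is \<open>O(1/\<delta>)\<close>.

In the Dirichlet problem the substitution \<open>s = (t - \<tau>)/\<epsilon>\<close> turns the boundary term into an integral over
\<open>(0, t/\<epsilon>)\<close> whose completion to \<open>(0, \<infinity>)\<close> is the Poisson integral by the Gamma integral. The missing tail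
and the interior term are both of order \<open>x\<^sub>N (\<epsilon>/t)\<^bsup>1/2\<^esup>\<close>. As \<open>\<epsilon> \<rightarrow> \<infinity>\<close> the kernel time \<open>t/\<epsilon>\<close> tends
to zero, so \<open>G0\<close> is an approximate identity and the boundary term vanishes.
\<close>

lemma abs_integral_le_nn_integral:
  fixes f :: "'b \<Rightarrow> real"
  assumes "(\<integral>\<^sup>+x. ennreal \<bar>f x\<bar> \<partial>M) \<le> ennreal C" "0 \<le> C"
  shows "\<bar>\<integral>x. f x \<partial>M\<bar> \<le> C"
proof (cases "integrable M f")
  case True
  have "ennreal (norm (\<integral>x. f x \<partial>M)) \<le> ennreal C"
    using order_trans[OF integral_norm_bound_ennreal[OF True]] assms(1) by simp
  then show ?thesis using assms(2) by simp
qed (simp add: not_integrable_integral_eq assms(2))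

lemma
  fixes f :: "'b::euclidean_space \<Rightarrow> 'c::euclidean_space \<Rightarrow> real"
  assumes "case_prod f \<in> borel_measurable (lborel \<Otimes>\<^sub>M lborel)"
    and bound: "(\<integral>\<^sup>+s. \<integral>\<^sup>+y. ennreal \<bar>f s y\<bar> \<partial>lborel \<partial>lborel) \<le> ennreal C" "0 \<le> C"
  shows Fubini_bounded: "(\<integral>y. \<integral>s. f s y \<partial>lborel \<partial>lborel) = (\<integral>s. \<integral>y. f s y \<partial>lborel \<partial>lborel)"
    and Fubini_bounded_abs: "\<bar>\<integral>y. \<integral>s. f s y \<partial>lborel \<partial>lborel\<bar> \<le> C"
    and Fubini_bounded_integrable: "integrable lborel (\<lambda>y. \<integral>s. f s y \<partial>lborel)"
proof -
  define F where "F = case_prod f"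
  have F: "F (s, y) = f s y" for s y by (simp add: F_def)
  have [measurable]: "F \<in> borel_measurable (lborel \<Otimes>\<^sub>M lborel)"
    using assms(1) unfolding F_def .
  have meas: "(\<lambda>p. ennreal \<bar>F p\<bar>) \<in> borel_measurable (lborel \<Otimes>\<^sub>M lborel)"
    by measurable
  have nn: "(\<integral>\<^sup>+p. ennreal \<bar>F p\<bar> \<partial>(lborel \<Otimes>\<^sub>M lborel)) \<le> ennreal C"
    using bound(1) lborel.nn_integral_fst[OF meas] by (simp only: F)
  have int: "integrable (lborel \<Otimes>\<^sub>M lborel) F"
    by (rule integrableI_bounded) (use order_le_less_trans[OF nn] in simp_all)
  note int' = int[unfolded F_def]
  show "(\<integral>y. \<integral>s. f s y \<partial>lborel \<partial>lborel) = (\<integral>s. \<integral>y. f s y \<partial>lborel \<partial>lborel)"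
    by (rule lborel_pair.Fubini_integral[OF int'])
  show "integrable lborel (\<lambda>y. \<integral>s. f s y \<partial>lborel)"
    by (rule lborel_pair.integrable_snd[OF int'])
  have "\<bar>integral\<^sup>L (lborel \<Otimes>\<^sub>M lborel) F\<bar> \<le> C"
    by (rule abs_integral_le_nn_integral[OF nn bound(2)])
  moreover have "(\<integral>y. \<integral>s. f s y \<partial>lborel \<partial>lborel) = integral\<^sup>L (lborel \<Otimes>\<^sub>M lborel) F"
    unfolding F_def by (rule lborel_pair.integral_snd[OF int'])
  ultimately show "\<bar>\<integral>y. \<integral>s. f s y \<partial>lborel \<partial>lborel\<bar> \<le> C" by simp
qed

lemma nn_integral_translate_diff:
  fixes f :: "'b::euclidean_space \<Rightarrow> ennreal"
  assumes [measurable]: "f \<in> borel_measurable borel"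
  shows "(\<integral>\<^sup>+y. f (y - x) \<partial>lborel) = (\<integral>\<^sup>+y. f y \<partial>lborel)"
proof -
  have "(\<integral>\<^sup>+y. f y \<partial>distr lborel borel ((+) (- x))) = (\<integral>\<^sup>+y. f (- x + y) \<partial>lborel)"
    by (rule nn_integral_distr) auto
  then show ?thesis by (simp add: lborel_distr_plus)
qed

section \<open>Heat kernel estimates\<close>

lemma borel_measurable_Gam [measurable (raw)]:
  assumes [measurable]: "f \<in> borel_measurable M" "g \<in> borel_measurable M"
  shows "(\<lambda>x. Gam d (f x) (g x)) \<in> borel_measurable M"
  unfolding Gam_def by measurable

lemma borel_measurable_dGam1 [measurable (raw)]:
  assumes [measurable]: "f \<in> borel_measurable M" "g \<in> borel_measurable M"
  shows "(\<lambda>x. dGam1 (f x) (g x)) \<in> borel_measurable M"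
  unfolding dGam1_def by measurable

lemma Gam_nonneg [simp]: "0 \<le> Gam d r s"
  by (simp add: Gam_def)

lemma Gam_minus [simp]: "Gam d (- r) s = Gam d r s"
  by (simp add: Gam_def)

lemma Gam_1:
  assumes "0 < s"
  shows "Gam 1 \<xi> s = exp (- \<xi>\<^sup>2 / (4 * s)) / sqrt (4 * pi * s)"
proof -
  have "(4 * pi * s) powr (- (1 / 2)) = 1 / sqrt (4 * pi * s)"
    using assms by (simp add: powr_minus_divide powr_half_sqrt)
  then show ?thesis by (simp add: Gam_def)
qed

lemma Gam_double:
  "0 < s \<Longrightarrow> Gam d r s = 2 powr (d / 2) * exp (- r\<^sup>2 / (8 * s)) * Gam d r (2 * s)"
proof -
  assume s: "0 < s"
  have "(4 * pi * (2 * s)) powr (- real d / 2) = (2 * (4 * pi * s)) powr (- real d / 2)"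
    by (simp add: mult_ac)
  also have "\<dots> = 2 powr (- (real d / 2)) * (4 * pi * s) powr (- real d / 2)"
    using s by (subst powr_mult) auto
  finally have *: "(4 * pi * (2 * s)) powr (- real d / 2)
      = 2 powr (- (real d / 2)) * (4 * pi * s) powr (- real d / 2)" .
  have "exp (- r\<^sup>2 / (8 * s)) * exp (- r\<^sup>2 / (8 * s)) = exp (- r\<^sup>2 / (4 * s))"
    by (simp add: exp_add[symmetric] field_simps)
  then show ?thesis
    unfolding Gam_def * by (simp add: powr_minus field_simps)
qed

lemma Gam_prod:
  fixes z :: "'a::euclidean_space" and r :: real
  assumes "0 < s"
  shows "Gam (DIM('a) + 1) (norm (z, r)) s = Gam DIM('a) (norm z) s * Gam 1 r s"
proof -
  have "(4 * pi * s) powr (- real (DIM('a) + 1) / 2)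
      = (4 * pi * s) powr (- real DIM('a) / 2) * (4 * pi * s) powr (- real 1 / 2)"
    by (simp add: powr_add[symmetric] field_simps)
  moreover have "exp (- (norm (z, r))\<^sup>2 / (4 * s)) = exp (- (norm z)\<^sup>2 / (4 * s)) * exp (- r\<^sup>2 / (4 * s))"
    by (simp add: exp_add[symmetric] norm_Pair diff_divide_distrib)
  ultimately show ?thesis by (simp only: Gam_def mult_ac)
qed

lemma nn_integral_Gam1:
  assumes "0 < s"
  shows "(\<integral>\<^sup>+\<xi>. ennreal (Gam 1 \<xi> s) \<partial>lborel) = 1"
proof -
  have "Gam 1 \<xi> s = normal_density 0 (sqrt (2 * s)) \<xi>" for \<xi>
    using assms by (simp add: Gam_1[unfolded One_nat_def] normal_density_def)
  moreover have "integrable lborel (normal_density 0 (sqrt (2 * s)))" using assms by simp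
  ultimately show ?thesis using assms by (simp add: nn_integral_eq_integral)
qed

lemma nn_integral_Gam_norm:
  assumes s: "0 < s"
  shows "(\<integral>\<^sup>+z. ennreal (Gam DIM('a::euclidean_space) (norm (z :: 'a)) s) \<partial>lborel) = 1"
proof -
  have "Gam DIM('a) (norm z) s = (\<Prod>b\<in>Basis. Gam 1 (z \<bullet> b) s)" for z :: 'a
  proof -
    have "(\<Prod>b\<in>(Basis::'a set). (4 * pi * s) powr (- real 1 / 2)) = (4 * pi * s) powr (- real DIM('a) / 2)"
      using s by (simp add: powr_realpow[symmetric] powr_powr)
    moreover have "(\<Prod>b\<in>Basis. exp (- (z \<bullet> b)\<^sup>2 / (4 * s))) = exp (- (norm z)\<^sup>2 / (4 * s))"
      by (simp add: exp_sum[symmetric] norm_eq_sqrt_inner euclidean_inner[of z z]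
        sum_nonneg sum_negf sum_divide_distrib power2_eq_square)
    ultimately show ?thesis unfolding Gam_def prod.distrib by simp
  qed
  then show ?thesis
    using nn_integral_lborel_prod[where 'a = 'a, of "\<lambda>_ x. ennreal (Gam 1 x s)"] s
    by (simp add: prod_ennreal nn_integral_Gam1[unfolded One_nat_def])
qed

lemma nn_integral_Gam:
  fixes x :: "'a::euclidean_space"
  assumes s: "0 < s"
  shows "(\<integral>\<^sup>+y. ennreal (Gam DIM('a) (norm (x - y)) s) \<partial>lborel) = 1"
  using nn_integral_translate_diff[of "\<lambda>z::'a. ennreal (Gam DIM('a) (norm z) s)" x]
  by (simp add: nn_integral_Gam_norm s norm_minus_commute)

lemma
  fixes x :: "'a::euclidean_space"
  assumes s: "0 < s"
  shows integrable_Gam: "integrable lborel (\<lambda>y. Gam DIM('a) (norm (x - y)) s)"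
    and integral_Gam: "(\<integral>y. Gam DIM('a) (norm (x - y)) s \<partial>lborel) = 1"
proof -
  show *: "integrable lborel (\<lambda>y. Gam DIM('a) (norm (x - y)) s)"
    by (rule integrableI_nonneg) (simp_all add: nn_integral_Gam s)
  show "(\<integral>y. Gam DIM('a) (norm (x - y)) s \<partial>lborel) = 1"
    using nn_integral_Gam[OF s, of x] nn_integral_eq_integral[OF *]
    by simp
qed

lemma nn_integral_Gam_prod:
  fixes x' :: "'a::euclidean_space" and g :: "real \<Rightarrow> real"
  assumes s: "0 < s" and [measurable]: "g \<in> borel_measurable borel"
  shows "(\<integral>\<^sup>+y. ennreal \<bar>Gam DIM('a) (norm (x' - fst y)) s * g (snd y)\<bar> \<partial>lborel)
    = (\<integral>\<^sup>+\<eta>. ennreal \<bar>g \<eta>\<bar> \<partial>lborel)"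
proof -
  have "(\<integral>\<^sup>+y. ennreal \<bar>Gam DIM('a) (norm (x' - fst y)) s * g (snd y)\<bar> \<partial>lborel)
      = (\<integral>\<^sup>+\<eta>. \<integral>\<^sup>+y'. ennreal (Gam DIM('a) (norm (x' - y')) s) * ennreal \<bar>g \<eta>\<bar> \<partial>lborel \<partial>lborel)"
    unfolding lborel_prod[symmetric]
    by (subst lborel_pair.nn_integral_snd[symmetric]) (simp_all add: abs_mult ennreal_mult)
  also have "\<dots> = (\<integral>\<^sup>+\<eta>. ennreal \<bar>g \<eta>\<bar> \<partial>lborel)"
    by (simp add: nn_integral_multc nn_integral_Gam s)
  finally show ?thesis .
qed

lemma exp_minus_le_inverse: "0 < p \<Longrightarrow> exp (- p) \<le> 1 / (p::real)"
  using exp_gt_self[of p] by (simp add: exp_minus field_simps less_imp_le)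

lemma exp_minus_le_inverse_square: "0 < p \<Longrightarrow> exp (- p) \<le> 4 / (p::real)\<^sup>2"
proof -
  assume "0 < p"
  then have "exp (- (p/2)) * exp (- (p/2)) \<le> (1 / (p/2)) * (1 / (p/2))"
    by (intro mult_mono exp_minus_le_inverse) auto
  then show ?thesis by (simp add: exp_add[symmetric] power2_eq_square)
qed

lemma Gam1_le_inverse:
  assumes "0 < s" "0 < \<xi>"
  shows "Gam 1 \<xi> s \<le> 1 / \<xi>"
proof -
  define r where "r = \<xi> / sqrt (4 * s)"
  have r: "0 < r" "r\<^sup>2 = \<xi>\<^sup>2 / (4 * s)" using assms by (auto simp: r_def power_divide)
  have "r \<le> 1 + r\<^sup>2" using sum_squares_bound[of r 1] r by simp
  also have "\<dots> \<le> exp (r\<^sup>2)" by (rule exp_ge_add_one_self)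
  finally have "exp (- r\<^sup>2) \<le> 1 / r" using r by (simp add: exp_minus field_simps)
  have "Gam 1 \<xi> s = exp (- r\<^sup>2) / (sqrt pi * sqrt (4 * s))"
    using assms by (simp add: Gam_1[unfolded One_nat_def] r real_sqrt_mult)
  also have "\<dots> \<le> exp (- r\<^sup>2) / (1 * sqrt (4 * s))"
    using assms pi_ge_two by (intro divide_left_mono mult_right_mono) auto
  also have "\<dots> \<le> (1 / r) / (1 * sqrt (4 * s))"
    using \<open>exp (- r\<^sup>2) \<le> 1 / r\<close> assms by (intro divide_right_mono) auto
  also have "\<dots> = 1 / \<xi>" using assms by (simp add: r_def)
  finally show ?thesis .
qed

lemma abs_dGam1_le_Gam1:
  assumes "0 < s" "0 < L" "L \<le> \<xi>"
  shows "\<bar>dGam1 \<xi> s\<bar> \<le> 256 / L ^ 3 * s * Gam 1 \<xi> (2 * s)"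
proof -
  have \<xi>: "0 < \<xi>" using assms by simp
  have "sqrt 2 \<le> 2" by (rule real_le_lsqrt) auto
  have "exp (- \<xi>\<^sup>2 / (8 * s)) \<le> 4 / (\<xi>\<^sup>2 / (8 * s))\<^sup>2"
    using exp_minus_le_inverse_square[of "\<xi>\<^sup>2 / (8 * s)"] assms \<xi> by simp
  then have e: "\<xi> / (2 * s) * 2 * exp (- \<xi>\<^sup>2 / (8 * s)) \<le> \<xi> / (2 * s) * 2 * (4 / (\<xi>\<^sup>2 / (8 * s))\<^sup>2)"
    using assms \<xi> by (intro mult_left_mono) auto
  also have "\<dots> = 256 / \<xi> ^ 3 * s"
    using assms \<xi> by (simp add: field_simps eval_nat_numeral)
  also have "\<dots> \<le> 256 / L ^ 3 * s"
    using assms by (intro mult_right_mono divide_left_mono power_mono mult_pos_pos zero_less_power) auto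
  finally have e: "\<xi> / (2 * s) * 2 * exp (- \<xi>\<^sup>2 / (8 * s)) \<le> 256 / L ^ 3 * s" .
  have "\<bar>dGam1 \<xi> s\<bar> = \<xi> / (2 * s) * (sqrt 2 * exp (- \<xi>\<^sup>2 / (8 * s))) * Gam 1 \<xi> (2 * s)"
    using assms \<xi> Gam_double[of s 1 \<xi>] by (simp add: dGam1_def abs_mult powr_half_sqrt)
  also have "\<dots> \<le> \<xi> / (2 * s) * (2 * exp (- \<xi>\<^sup>2 / (8 * s))) * Gam 1 \<xi> (2 * s)"
    using assms \<xi> \<open>sqrt 2 \<le> 2\<close> by (intro mult_left_mono mult_right_mono) auto
  also have "\<dots> \<le> 256 / L ^ 3 * s * Gam 1 \<xi> (2 * s)"
    using e by (intro mult_right_mono) (auto simp: mult_ac)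
  finally show ?thesis .
qed

lemma abs_dGam1_le:
  assumes "0 < s" "0 < L" "L \<le> \<xi>"
  shows "\<bar>dGam1 \<xi> s\<bar> \<le> 256 / L ^ 4 * s"
proof -
  have "Gam 1 \<xi> (2 * s) \<le> 1 / \<xi>" using assms by (intro Gam1_le_inverse) auto
  also have "\<dots> \<le> 1 / L" using assms by (intro divide_left_mono) auto
  finally have "256 / L ^ 3 * s * Gam 1 \<xi> (2 * s) \<le> 256 / L ^ 3 * s * (1 / L)"
    using assms by (intro mult_left_mono) auto
  with abs_dGam1_le_Gam1[OF assms] show ?thesis
    by (simp add: eval_nat_numeral mult_ac)
qed

lemma DERIV_dGam1:
  assumes "0 < s"
  shows "((\<lambda>\<xi>. dGam1 \<xi> s) has_real_derivative (- 1 / (2 * s) + (\<xi> / (2 * s))\<^sup>2) * Gam 1 \<xi> s) (at \<xi>)"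
  unfolding dGam1_def Gam_def using assms
  by (auto intro!: derivative_eq_intros simp: field_simps power2_eq_square)

lemma abs_deriv_dGam1_le:
  assumes "0 < s" "0 < L" "L \<le> \<xi>"
  shows "\<bar>(- 1 / (2 * s) + (\<xi> / (2 * s))\<^sup>2) * Gam 1 \<xi> s\<bar> \<le> 128 / L ^ 3"
proof -
  have \<xi>: "0 < \<xi>" using assms by simp
  define q where "q = \<xi>\<^sup>2 / (8 * s)"
  have q: "0 < q" using assms \<xi> by (simp add: q_def)
  have "sqrt 2 \<le> 2" by (rule real_le_lsqrt) auto
  have "1 / 2 + 2 * q \<le> 2 * exp q" using exp_ge_add_one_self[of q] by linarith
  have "\<bar>- 1 / (2 * s) + (\<xi> / (2 * s))\<^sup>2\<bar> \<le> 1 / (2 * s) + (\<xi> / (2 * s))\<^sup>2"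
    using assms by (intro order_trans[OF abs_triangle_ineq]) auto
  also have "\<dots> = (1 / 2 + 2 * q) / s"
    using assms by (simp add: q_def power2_eq_square field_simps)
  also have "\<dots> \<le> 2 * exp q / s"
    using \<open>1 / 2 + 2 * q \<le> 2 * exp q\<close> assms by (intro divide_right_mono) auto
  finally have 1: "\<bar>- 1 / (2 * s) + (\<xi> / (2 * s))\<^sup>2\<bar> \<le> 2 * exp q / s" .
  have 2: "Gam 1 \<xi> s \<le> 2 * exp (- q) * Gam 1 \<xi> (2 * s)"
    using Gam_double[of s 1 \<xi>] assms \<open>sqrt 2 \<le> 2\<close>
    by (simp add: q_def powr_half_sqrt mult_right_mono)
  have "exp (- \<xi>\<^sup>2 / (16 * s)) \<le> 16 * s / \<xi>\<^sup>2"
    using exp_minus_le_inverse[of "\<xi>\<^sup>2 / (16 * s)"] assms \<xi> by simp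
  moreover have "Gam 1 \<xi> (4 * s) \<le> 1 / \<xi>" using assms by (intro Gam1_le_inverse) auto
  ultimately have "sqrt 2 * exp (- \<xi>\<^sup>2 / (16 * s)) * Gam 1 \<xi> (4 * s) \<le> 2 * (16 * s / \<xi>\<^sup>2) * (1 / \<xi>)"
    using assms \<xi> \<open>sqrt 2 \<le> 2\<close> by (intro mult_mono) auto
  then have 3: "Gam 1 \<xi> (2 * s) \<le> 32 * s / \<xi> ^ 3"
    using Gam_double[of "2 * s" 1 \<xi>] assms by (simp add: powr_half_sqrt eval_nat_numeral mult_ac)
  have "\<bar>(- 1 / (2 * s) + (\<xi> / (2 * s))\<^sup>2) * Gam 1 \<xi> s\<bar>
      \<le> 2 * exp q / s * (2 * exp (- q) * (32 * s / \<xi> ^ 3))"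
    unfolding abs_mult using 1 order_trans[OF 2 mult_left_mono[OF 3]] assms
    by (intro mult_mono) auto
  also have "\<dots> = 128 / \<xi> ^ 3" using assms \<xi> by (simp add: exp_minus field_simps)
  also have "\<dots> \<le> 128 / L ^ 3"
    using assms by (intro divide_left_mono power_mono mult_pos_pos zero_less_power) auto
  finally show ?thesis .
qed

lemma dGam1_lipschitz:
  assumes "0 < s" "0 < L" "L \<le> \<xi>" "0 \<le> h"
  shows "\<bar>dGam1 (\<xi> + h) s - dGam1 \<xi> s\<bar> \<le> 128 / L ^ 3 * h"
proof (cases "h = 0")
  case False
  then have "\<xi> < \<xi> + h" using assms by simp
  then obtain z where z: "\<xi> < z"
    "dGam1 (\<xi> + h) s - dGam1 \<xi> s = (\<xi> + h - \<xi>) * ((- 1 / (2 * s) + (z / (2 * s))\<^sup>2) * Gam 1 z s)"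
    using MVT2[OF _ DERIV_dGam1[OF assms(1)], of \<xi> "\<xi> + h"] by blast
  have "h * \<bar>(- 1 / (2 * s) + (z / (2 * s))\<^sup>2) * Gam 1 z s\<bar> \<le> h * (128 / L ^ 3)"
    using z assms by (intro mult_left_mono abs_deriv_dGam1_le) auto
  with z assms show ?thesis by (simp add: abs_mult mult_ac)
qed simp

section \<open>The heat semigroup on the boundary\<close>

definition heat :: "('a::euclidean_space \<Rightarrow> real) \<Rightarrow> 'a \<Rightarrow> real \<Rightarrow> real" where
  "heat \<psi> a s = (\<integral>y. Gam DIM('a) (norm (a - y)) s * \<psi> y \<partial>lborel)"

lemma nn_integral_Gam_mult_le:
  fixes a :: "'a::euclidean_space"
  assumes s: "0 < s" and M: "\<And>y. \<bar>\<psi> y\<bar> \<le> M"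
  shows "(\<integral>\<^sup>+y. ennreal \<bar>Gam DIM('a) (norm (a - y)) s * \<psi> y\<bar> \<partial>lborel) \<le> ennreal M"
proof -
  have M0: "0 \<le> M" using M[of undefined] by linarith
  have "(\<integral>\<^sup>+y. ennreal \<bar>Gam DIM('a) (norm (a - y)) s * \<psi> y\<bar> \<partial>lborel)
      \<le> (\<integral>\<^sup>+y. ennreal (Gam DIM('a) (norm (a - y)) s) * ennreal M \<partial>lborel)"
    by (intro nn_integral_mono)
      (auto simp: abs_mult ennreal_mult[symmetric] M0 intro!: ennreal_leI mult_left_mono M)
  also have "\<dots> = ennreal M" by (simp add: nn_integral_multc nn_integral_Gam s)
  finally show ?thesis .
qed

lemma integrable_Gam_mult:
  fixes a :: "'a::euclidean_space"
  assumes [measurable]: "\<psi> \<in> borel_measurable borel" and s: "0 < s" and M: "\<And>y. \<bar>\<psi> y\<bar> \<le> M"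
  shows "integrable lborel (\<lambda>y. Gam DIM('a) (norm (a - y)) s * \<psi> y)"
proof (rule integrableI_bounded)
  show "(\<integral>\<^sup>+y. ennreal (norm (Gam DIM('a) (norm (a - y)) s * \<psi> y)) \<partial>lborel) < \<infinity>"
    using order_le_less_trans[OF nn_integral_Gam_mult_le[where \<psi> = \<psi> and a = a, OF s M]] by simp
qed measurable

lemma abs_heat_le:
  assumes s: "0 < s" and M: "\<And>y. \<bar>\<psi> y\<bar> \<le> M"
  shows "\<bar>heat \<psi> a s\<bar> \<le> M"
proof -
  have "0 \<le> M" using M[of undefined] by linarith
  then show ?thesis
    unfolding heat_def by (intro abs_integral_le_nn_integral nn_integral_Gam_mult_le s M)
qed

lemma borel_measurable_heat [measurable (raw)]:
  fixes a :: "'a::euclidean_space"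
  assumes [measurable]: "\<psi> \<in> borel_measurable borel" "f \<in> borel_measurable N"
  shows "(\<lambda>x. heat \<psi> a (f x)) \<in> borel_measurable N"
  unfolding heat_def by measurable

text \<open>With \<open>\<rho> = (s\<^sub>1/s\<^sub>2)\<^bsup>d/2\<^esup>\<close> the function \<open>\<rho> \<Gamma>(\<cdot>,s\<^sub>1)\<close> lies below both heat kernels, so the
  \<open>L\<^sup>1\<close> distance is at most \<open>2 (1 - \<rho>)\<close>.\<close>

lemma nn_integral_Gam_diff_le:
  fixes a :: "'a::euclidean_space" and s1 s2 :: real
  assumes s: "0 < s1" "s1 \<le> s2"
  shows "(\<integral>\<^sup>+y. ennreal \<bar>Gam DIM('a) (norm (a - y)) s2 - Gam DIM('a) (norm (a - y)) s1\<bar> \<partial>lborel)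
    \<le> ennreal (2 * DIM('a) * (s2 - s1) / s2)"
proof -
  define d where "d = real DIM('a)"
  have d: "0 \<le> d" by (simp add: d_def)
  define \<rho> where "\<rho> = (s1 / s2) powr (d / 2)"
  let ?\<Gamma> = "\<lambda>s y. Gam DIM('a) (norm (a - y)) s"
  have r: "0 < s1 / s2" "s1 / s2 \<le> 1" using s by auto
  have \<rho>1: "\<rho> \<le> 1" using r d unfolding \<rho>_def by (intro powr_le1) auto
  have "1 + d * (s1 / s2 - 1) \<le> (1 + (s1 / s2 - 1)) ^ DIM('a)"
    unfolding d_def using r by (intro Bernoulli_inequality) auto
  also have "\<dots> = (s1 / s2) powr d" using r by (simp add: d_def powr_realpow)
  also have "\<dots> \<le> \<rho>" unfolding \<rho>_def using r d by (intro powr_mono') auto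
  finally have "1 - \<rho> \<le> d * (1 - s1 / s2)" by (simp add: right_diff_distrib)
  then have "2 * (1 - \<rho>) \<le> 2 * (d * (1 - s1 / s2))" by (intro mult_left_mono) auto
  also have "\<dots> = 2 * d * (s2 - s1) / s2" using s by (simp add: field_simps)
  finally have \<rho>2: "2 * (1 - \<rho>) \<le> 2 * d * (s2 - s1) / s2" .
  have low: "\<rho> * ?\<Gamma> s1 y \<le> ?\<Gamma> s2 y" for y
  proof -
    have q: "4 * pi * s2 = 4 * pi * s1 / (s1 / s2)" using s by simp
    have "(4 * pi * s2) powr (- d / 2) = (4 * pi * s1 / (s1 / s2)) powr (- d / 2)"
      by (rule arg_cong2[where f = "(powr)", OF q HOL.refl])
    also have "\<dots> = (4 * pi * s1) powr (- d / 2) / (s1 / s2) powr (- d / 2)"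
      by (rule powr_divide)
    also have "\<dots> = \<rho> * (4 * pi * s1) powr (- d / 2)"
      by (simp add: \<rho>_def powr_minus divide_simps)
    finally have *: "(4 * pi * s2) powr (- d / 2) = \<rho> * (4 * pi * s1) powr (- d / 2)" .
    have "(norm (a - y))\<^sup>2 / (4 * s2) \<le> (norm (a - y))\<^sup>2 / (4 * s1)"
      using s by (intro divide_left_mono) auto
    then have "exp (- (norm (a - y))\<^sup>2 / (4 * s1)) \<le> exp (- (norm (a - y))\<^sup>2 / (4 * s2))" by simp
    then have "\<rho> * (4 * pi * s1) powr (- d / 2) * exp (- (norm (a - y))\<^sup>2 / (4 * s1))
       \<le> \<rho> * (4 * pi * s1) powr (- d / 2) * exp (- (norm (a - y))\<^sup>2 / (4 * s2))"
      by (intro mult_left_mono) (auto simp: \<rho>_def)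
    then show ?thesis unfolding Gam_def d_def[symmetric] * by (simp add: mult_ac)
  qed
  have pt: "\<bar>?\<Gamma> s2 y - ?\<Gamma> s1 y\<bar> \<le> ?\<Gamma> s2 y + (1 - 2 * \<rho>) * ?\<Gamma> s1 y" for y
  proof -
    have "\<rho> * ?\<Gamma> s1 y \<le> ?\<Gamma> s1 y" using \<rho>1 by (simp add: mult_left_le_one_le \<rho>_def)
    with low[of y] show ?thesis by (simp add: algebra_simps abs_le_iff)
  qed
  have int: "integrable lborel (?\<Gamma> s1)" "integrable lborel (?\<Gamma> s2)"
    using s by (auto intro!: integrable_Gam)
  have "(\<integral>\<^sup>+y. ennreal \<bar>?\<Gamma> s2 y - ?\<Gamma> s1 y\<bar> \<partial>lborel)
      \<le> (\<integral>\<^sup>+y. ennreal (?\<Gamma> s2 y + (1 - 2 * \<rho>) * ?\<Gamma> s1 y) \<partial>lborel)"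
    by (intro nn_integral_mono ennreal_leI pt)
  also have "\<dots> = ennreal (\<integral>y. ?\<Gamma> s2 y + (1 - 2 * \<rho>) * ?\<Gamma> s1 y \<partial>lborel)"
    using int order_trans[OF abs_ge_zero pt] by (intro nn_integral_eq_integral) auto
  also have "(\<integral>y. ?\<Gamma> s2 y + (1 - 2 * \<rho>) * ?\<Gamma> s1 y \<partial>lborel) = 2 * (1 - \<rho>)"
    using int s by (simp add: integral_Gam algebra_simps)
  finally show ?thesis using \<rho>2 by (auto simp: d_def intro: order_trans ennreal_leI)
qed

lemma heat_diff_le:
  fixes a :: "'a::euclidean_space" and s1 s2 :: real
  assumes [measurable]: "\<psi> \<in> borel_measurable borel" and M: "\<And>y. \<bar>\<psi> y\<bar> \<le> M"
    and s: "0 < s1" "s1 \<le> s2"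
  shows "\<bar>heat \<psi> a s2 - heat \<psi> a s1\<bar> \<le> M * (2 * DIM('a) * (s2 - s1) / s2)"
proof -
  let ?\<Gamma> = "\<lambda>s y. Gam DIM('a) (norm (a - y)) s"
  have M0: "0 \<le> M" using M[of undefined] by linarith
  have "heat \<psi> a s2 - heat \<psi> a s1 = (\<integral>y. (?\<Gamma> s2 y - ?\<Gamma> s1 y) * \<psi> y \<partial>lborel)"
    unfolding heat_def left_diff_distrib using assms
    by (intro Bochner_Integration.integral_diff[symmetric] integrable_Gam_mult) auto
  also have "\<bar>\<dots>\<bar> \<le> M * (2 * DIM('a) * (s2 - s1) / s2)"
  proof (rule abs_integral_le_nn_integral)
    have "(\<integral>\<^sup>+y. ennreal \<bar>(?\<Gamma> s2 y - ?\<Gamma> s1 y) * \<psi> y\<bar> \<partial>lborel)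
        \<le> (\<integral>\<^sup>+y. ennreal M * ennreal \<bar>?\<Gamma> s2 y - ?\<Gamma> s1 y\<bar> \<partial>lborel)"
      unfolding abs_mult ennreal_mult''[OF abs_ge_zero, symmetric]
      using M by (intro nn_integral_mono ennreal_leI) (simp add: mult.commute[of M] mult_left_mono)
    also have "\<dots> = ennreal M * (\<integral>\<^sup>+y. ennreal \<bar>?\<Gamma> s2 y - ?\<Gamma> s1 y\<bar> \<partial>lborel)"
      by (rule nn_integral_cmult) measurable
    also have "\<dots> \<le> ennreal M * ennreal (2 * DIM('a) * (s2 - s1) / s2)"
      by (intro mult_left_mono nn_integral_Gam_diff_le s) auto
    finally show "(\<integral>\<^sup>+y. ennreal \<bar>(?\<Gamma> s2 y - ?\<Gamma> s1 y) * \<psi> y\<bar> \<partial>lborel)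
        \<le> ennreal (M * (2 * DIM('a) * (s2 - s1) / s2))"
      by (simp only: ennreal_mult'[OF M0])
  qed (use M0 s in auto)
  finally show ?thesis .
qed

lemma DIM_prod_real: "DIM('a::euclidean_space \<times> real) = DIM('a) + 1"
  by simp

lemma norm_diff_refl: "norm (x - refl y) = norm (refl x - y)"
proof -
  have "(snd x + snd y)\<^sup>2 = (- snd x - snd y)\<^sup>2" by (simp add: power2_eq_square algebra_simps)
  then show ?thesis by (simp add: refl_def norm_prod_def)
qed

lemma Gam_half_space:
  fixes x y :: "'a::euclidean_space \<times> real"
  assumes "0 < s"
  shows "Gam (DIM('a) + 1) (norm (x - y)) s
      = Gam DIM('a) (norm (fst x - fst y)) s * Gam 1 (snd x - snd y) s"
    and "Gam (DIM('a) + 1) (norm (x - refl y)) s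
      = Gam DIM('a) (norm (fst x - fst y)) s * Gam 1 (snd x + snd y) s"
  using Gam_prod[OF assms, of "fst x - fst y" "snd x - snd y"]
    Gam_prod[OF assms, of "fst x - fst y" "snd x + snd y"]
  by (simp_all add: minus_prod_def refl_def)

section \<open>Comparison of the dynamic and the Dirichlet problem\<close>

lemma measurable_Omega [measurable]: "(Omega :: ('a::euclidean_space \<times> real) set) \<in> sets borel"
  unfolding Omega_def by (intro borel_open open_Times) auto

lemma borel_measurable_refl [measurable]: "refl \<in> borel_measurable borel"
  unfolding refl_def by (intro borel_measurable_continuous_onI continuous_intros)

lemma borel_measurable_G0 [measurable]:
  fixes x :: "'a::euclidean_space \<times> real"
  shows "(\<lambda>y. G0 x y s) \<in> borel_measurable borel"
  unfolding G0_def by measurable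

lemma integrable_G0:
  fixes x :: "'a::euclidean_space \<times> real"
  assumes [measurable]: "\<phi> \<in> borel_measurable borel" and M: "\<And>y. \<bar>\<phi> y\<bar> \<le> M" and s: "0 < s"
  shows "integrable lborel (\<lambda>y. G0 x y s * \<phi> y)"
  unfolding G0_def norm_diff_refl left_diff_distrib DIM_prod_real[symmetric]
  by (intro Bochner_Integration.integrable_diff integrable_Gam_mult[where M = M] assms)

lemma integrable_G0_Omega:
  fixes x :: "'a::euclidean_space \<times> real"
  assumes [measurable]: "\<phi> \<in> borel_measurable borel" and M: "\<And>y. \<bar>\<phi> y\<bar> \<le> M" and s: "0 < s"
  shows "set_integrable lborel Omega (\<lambda>y. G0 x y s * \<phi> y)"
  unfolding set_integrable_def
  by (intro integrable_mult_indicator integrable_G0[where M = M] assms) auto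

lemma w_dir_eq:
  assumes "0 \<le> t"
  shows "w_dir \<epsilon> \<phi> \<psi> x t = (LINT y:Omega|lborel. G0 x y (t / \<epsilon>) * \<phi> y)
    - 2 / \<epsilon> * (\<integral>\<tau>. indicator {0<..<t} \<tau> *
        (heat \<psi> (fst x) ((t - \<tau>) / \<epsilon>) * dGam1 (snd x) ((t - \<tau>) / \<epsilon>)) \<partial>lborel)"
proof -
  have "heat \<psi> (fst x) s * b = (\<integral>y'. Gam DIM('a) (norm (fst x - y')) s * b * \<psi> y' \<partial>lborel)" for s b
    unfolding heat_def integral_mult_left_zero[symmetric] by (simp add: mult_ac)
  then show ?thesis using assms
    by (simp add: w_dir_def zero_ereal_def interval_lebesgue_integral_le_eq set_lebesgue_integral_def)
qed

lemma Hk_eq: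
  fixes x :: "'a::euclidean_space \<times> real"
  assumes "0 \<le> t"
  shows "Hk \<epsilon> \<kappa> \<delta> x y t = - 2 * (\<integral>\<tau>. indicator {0<..<t} \<tau> *
      (Gam DIM('a) (norm (fst x - fst y)) ((t - \<tau>) / \<epsilon> + \<kappa> / \<delta> * \<tau>)
      * dGam1 (snd x + snd y + \<tau> / \<delta>) ((t - \<tau>) / \<epsilon>)) \<partial>lborel)"
  using assms
  by (simp add: Hk_def zero_ereal_def interval_lebesgue_integral_le_eq set_lebesgue_integral_def)

lemma nn_integral_indicator_le:
  fixes t :: real
  assumes f: "\<And>\<tau>. 0 < \<tau> \<Longrightarrow> \<tau> < t \<Longrightarrow> f \<tau> \<le> ennreal c"
    and f0: "\<And>\<tau>. \<not> (0 < \<tau> \<and> \<tau> < t) \<Longrightarrow> f \<tau> = 0" and c: "0 \<le> c" "0 \<le> t"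
  shows "(\<integral>\<^sup>+\<tau>. f \<tau> \<partial>lborel) \<le> ennreal (c * t)"
proof -
  have "(\<integral>\<^sup>+\<tau>. f \<tau> \<partial>lborel) \<le> (\<integral>\<^sup>+\<tau>. ennreal c * indicator {0<..<t} \<tau> \<partial>lborel)"
    using f f0 by (intro nn_integral_mono) (auto simp: indicator_def)
  also have "\<dots> = ennreal (c * t)"
    using c by (simp add: nn_integral_cmult_indicator ennreal_mult)
  finally show ?thesis .
qed

lemma Hk_interior:
  fixes x :: "'a::euclidean_space \<times> real"
  assumes [measurable]: "\<phi> \<in> borel_measurable borel" and M: "\<And>y. \<bar>\<phi> y\<bar> \<le> M"
    and pos: "0 < \<epsilon>" "0 \<le> \<kappa>" "0 < \<delta>" "0 < t" "0 < L" "L \<le> snd x"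
  shows "set_integrable lborel Omega (\<lambda>y. Hk \<epsilon> \<kappa> \<delta> x y t * \<phi> y)" (is ?I)
    and "\<bar>LINT y:Omega|lborel. Hk \<epsilon> \<kappa> \<delta> x y t * \<phi> y\<bar> \<le> 2 * (M * (256 / L ^ 3) * (t / \<epsilon>) * t)" (is ?B)
proof -
  define f where "f \<tau> y = indicator {0<..<t} \<tau> * (Gam DIM('a) (norm (fst x - fst y)) ((t - \<tau>) / \<epsilon> + \<kappa> / \<delta> * \<tau>)
      * dGam1 (snd x + snd y + \<tau> / \<delta>) ((t - \<tau>) / \<epsilon>)) * (indicator Omega y * \<phi> y)" for \<tau> :: real and y
  have M0: "0 \<le> M" using M[of undefined] by linarith
  have [measurable]: "fst \<in> borel \<rightarrow>\<^sub>M (borel :: 'a measure)" "snd \<in> borel \<rightarrow>\<^sub>M (borel :: real measure)"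
    by (auto intro!: borel_measurable_continuous_onI continuous_intros)
  have eq: "indicator Omega y *\<^sub>R (Hk \<epsilon> \<kappa> \<delta> x y t * \<phi> y) = - 2 * (\<integral>\<tau>. f \<tau> y \<partial>lborel)" for y
    using pos unfolding f_def by (simp add: Hk_eq)
  have meas: "case_prod f \<in> borel_measurable (lborel \<Otimes>\<^sub>M lborel)"
    unfolding f_def by measurable
  have bound: "(\<integral>\<^sup>+\<tau>. \<integral>\<^sup>+y. ennreal \<bar>f \<tau> y\<bar> \<partial>lborel \<partial>lborel) \<le> ennreal (M * (256 / L ^ 3) * (t / \<epsilon>) * t)"
  proof (rule nn_integral_indicator_le)
    fix \<tau> assume \<tau>: "0 < \<tau>" "\<tau> < t"
    define s where "s = (t - \<tau>) / \<epsilon>"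
    define c where "c = snd x + \<tau> / \<delta>"
    have s: "0 < s" "s \<le> t / \<epsilon>" using \<tau> pos by (auto simp: s_def divide_right_mono)
    have s': "0 < s + \<kappa> / \<delta> * \<tau>" using s pos \<tau> by (intro add_pos_nonneg) auto
    define K where "K = M * (256 / L ^ 3 * s)"
    have K0: "0 \<le> K" using M0 s pos by (auto simp: K_def)
    have "\<bar>f \<tau> y\<bar> \<le> \<bar>Gam DIM('a) (norm (fst x - fst y)) (s + \<kappa> / \<delta> * \<tau>) * (K * Gam 1 (snd y - (- c)) (2 * s))\<bar>" for y
    proof (cases "y \<in> Omega")
      case True
      then have "0 < snd y" by (auto simp: Omega_def)
      moreover have "0 < \<tau> / \<delta>" using \<tau> pos by simp
      ultimately have "\<bar>dGam1 (snd x + snd y + \<tau> / \<delta>) s\<bar>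
          \<le> 256 / L ^ 3 * s * Gam 1 (snd x + snd y + \<tau> / \<delta>) (2 * s)"
        using pos s by (intro abs_dGam1_le_Gam1) auto
      then have "\<bar>dGam1 (snd x + snd y + \<tau> / \<delta>) s\<bar> * \<bar>\<phi> y\<bar>
          \<le> (256 / L ^ 3 * s * Gam 1 (snd x + snd y + \<tau> / \<delta>) (2 * s)) * M"
        by (intro mult_mono M) (auto intro: order_trans[OF abs_ge_zero])
      also have "\<dots> = K * Gam 1 (snd y - (- c)) (2 * s)" by (simp add: K_def c_def algebra_simps)
      finally show ?thesis using True \<tau> K0
        by (simp add: f_def abs_mult s_def[symmetric] mult.assoc mult_left_mono)
    qed (simp add: f_def)
    then have "(\<integral>\<^sup>+y. ennreal \<bar>f \<tau> y\<bar> \<partial>lborel)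
      \<le> (\<integral>\<^sup>+y. ennreal \<bar>Gam DIM('a) (norm (fst x - fst y)) (s + \<kappa> / \<delta> * \<tau>) * (K * Gam 1 (snd y - (- c)) (2 * s))\<bar> \<partial>lborel)"
      by (intro nn_integral_mono ennreal_leI)
    also have "\<dots> = (\<integral>\<^sup>+\<eta>. ennreal \<bar>K * Gam 1 (\<eta> - (- c)) (2 * s)\<bar> \<partial>lborel)"
      by (rule nn_integral_Gam_prod[OF s']) measurable
    also have "\<dots> = (\<integral>\<^sup>+\<eta>. ennreal K * ennreal (Gam 1 \<eta> (2 * s)) \<partial>lborel)"
      by (subst nn_integral_translate_diff[where f = "\<lambda>\<eta>. ennreal \<bar>K * Gam 1 \<eta> (2 * s)\<bar>"])
        (use K0 in \<open>simp_all add: abs_mult ennreal_mult\<close>)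
    also have "\<dots> = ennreal K" using s nn_integral_Gam1[of "2 * s"] by (simp add: nn_integral_cmult)
    also have "\<dots> \<le> ennreal (M * (256 / L ^ 3) * (t / \<epsilon>))"
      unfolding K_def mult.assoc using s M0 pos by (intro ennreal_leI mult_left_mono) auto
    finally show "(\<integral>\<^sup>+y. ennreal \<bar>f \<tau> y\<bar> \<partial>lborel) \<le> ennreal (M * (256 / L ^ 3) * (t / \<epsilon>))" .
  next
    fix \<tau> assume "\<not> (0 < \<tau> \<and> \<tau> < t)"
    then show "(\<integral>\<^sup>+y. ennreal \<bar>f \<tau> y\<bar> \<partial>lborel) = 0" by (auto simp: f_def)
  qed (use M0 pos in auto)
  have B0: "0 \<le> M * (256 / L ^ 3) * (t / \<epsilon>) * t" using M0 pos by auto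
  show ?I unfolding set_integrable_def eq
    by (intro integrable_mult_right Fubini_bounded_integrable[OF meas bound B0])
  show ?B unfolding set_lebesgue_integral_def eq integral_mult_right_zero
    using Fubini_bounded_abs[OF meas bound B0] by simp
qed

lemma Hk_boundary:
  fixes x :: "'a::euclidean_space \<times> real"
  assumes [measurable]: "\<psi> \<in> borel_measurable borel" and M: "\<And>y. \<bar>\<psi> y\<bar> \<le> M"
    and pos: "0 < \<epsilon>" "0 \<le> \<kappa>" "0 < \<delta>" "0 < t" "0 < L" "L \<le> snd x"
  shows "(\<integral>y'. Hk \<epsilon> \<kappa> \<delta> x (y', 0) t * \<psi> y' \<partial>lborel)
    = - 2 * (\<integral>\<tau>. indicator {0<..<t} \<tau> * (heat \<psi> (fst x) ((t - \<tau>) / \<epsilon> + \<kappa> / \<delta> * \<tau>)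
        * dGam1 (snd x + \<tau> / \<delta>) ((t - \<tau>) / \<epsilon>)) \<partial>lborel)"
proof -
  define f where "f \<tau> y = indicator {0<..<t} \<tau> * (Gam DIM('a) (norm (fst x - y)) ((t - \<tau>) / \<epsilon> + \<kappa> / \<delta> * \<tau>)
      * dGam1 (snd x + \<tau> / \<delta>) ((t - \<tau>) / \<epsilon>)) * \<psi> y" for \<tau> :: real and y
  have M0: "0 \<le> M" using M[of undefined] by linarith
  have meas: "case_prod f \<in> borel_measurable (lborel \<Otimes>\<^sub>M lborel)"
    unfolding f_def by measurable
  have bound: "(\<integral>\<^sup>+\<tau>. \<integral>\<^sup>+y. ennreal \<bar>f \<tau> y\<bar> \<partial>lborel \<partial>lborel) \<le> ennreal (256 / L ^ 4 * (t / \<epsilon>) * M * t)"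
  proof (rule nn_integral_indicator_le)
    fix \<tau> assume \<tau>: "0 < \<tau>" "\<tau> < t"
    define s where "s = (t - \<tau>) / \<epsilon>"
    have s: "0 < s" "s \<le> t / \<epsilon>" using \<tau> pos by (auto simp: s_def divide_right_mono)
    have s': "0 < s + \<kappa> / \<delta> * \<tau>" using s pos \<tau> by (intro add_pos_nonneg) auto
    have "0 < \<tau> / \<delta>" using \<tau> pos by simp
    then have "\<bar>dGam1 (snd x + \<tau> / \<delta>) s\<bar> \<le> 256 / L ^ 4 * s"
      using pos s by (intro abs_dGam1_le) auto
    also have "\<dots> \<le> 256 / L ^ 4 * (t / \<epsilon>)" using s pos by (intro mult_left_mono) auto
    finally have D: "\<bar>dGam1 (snd x + \<tau> / \<delta>) s\<bar> \<le> 256 / L ^ 4 * (t / \<epsilon>)" .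
    have "(\<integral>\<^sup>+y. ennreal \<bar>f \<tau> y\<bar> \<partial>lborel)
      = (\<integral>\<^sup>+y. ennreal \<bar>dGam1 (snd x + \<tau> / \<delta>) s\<bar> * ennreal \<bar>Gam DIM('a) (norm (fst x - y)) (s + \<kappa> / \<delta> * \<tau>) * \<psi> y\<bar> \<partial>lborel)"
      using \<tau> unfolding f_def s_def[symmetric] by (simp add: abs_mult ennreal_mult[symmetric] mult_ac)
    also have "\<dots> = ennreal \<bar>dGam1 (snd x + \<tau> / \<delta>) s\<bar> * (\<integral>\<^sup>+y. ennreal \<bar>Gam DIM('a) (norm (fst x - y)) (s + \<kappa> / \<delta> * \<tau>) * \<psi> y\<bar> \<partial>lborel)"
      by (rule nn_integral_cmult) measurable
    also have "\<dots> \<le> ennreal (256 / L ^ 4 * (t / \<epsilon>)) * ennreal M"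
      by (intro mult_mono ennreal_leI D nn_integral_Gam_mult_le s' M) auto
    also have "\<dots> = ennreal (256 / L ^ 4 * (t / \<epsilon>) * M)"
      by (rule ennreal_mult''[OF M0, symmetric])
    finally show "(\<integral>\<^sup>+y. ennreal \<bar>f \<tau> y\<bar> \<partial>lborel) \<le> ennreal (256 / L ^ 4 * (t / \<epsilon>) * M)" .
  next
    fix \<tau> assume "\<not> (0 < \<tau> \<and> \<tau> < t)"
    then show "(\<integral>\<^sup>+y. ennreal \<bar>f \<tau> y\<bar> \<partial>lborel) = 0" by (auto simp: f_def)
  qed (use M0 pos in auto)
  have "(\<integral>y. \<integral>\<tau>. f \<tau> y \<partial>lborel \<partial>lborel) = (\<integral>\<tau>. \<integral>y. f \<tau> y \<partial>lborel \<partial>lborel)"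
    by (rule Fubini_bounded[OF meas bound]) (use M0 pos in auto)
  moreover have "Hk \<epsilon> \<kappa> \<delta> x (y', 0) t * \<psi> y' = - 2 * (\<integral>\<tau>. f \<tau> y' \<partial>lborel)" for y'
    using pos unfolding f_def by (simp add: Hk_eq)
  moreover have "(\<integral>y. f \<tau> y \<partial>lborel) = indicator {0<..<t} \<tau> * (heat \<psi> (fst x) ((t - \<tau>) / \<epsilon> + \<kappa> / \<delta> * \<tau>)
        * dGam1 (snd x + \<tau> / \<delta>) ((t - \<tau>) / \<epsilon>))" for \<tau>
    unfolding f_def heat_def integral_mult_right_zero[symmetric] integral_mult_left_zero[symmetric]
    by (simp add: mult_ac)
  ultimately show ?thesis by simp
qed

lemma
  fixes f :: "real \<Rightarrow> real"
  assumes [measurable]: "f \<in> borel_measurable borel"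
    and f: "\<And>\<tau>. 0 < \<tau> \<Longrightarrow> \<tau> < t \<Longrightarrow> \<bar>f \<tau>\<bar> \<le> c"
    and f0: "\<And>\<tau>. \<not> (0 < \<tau> \<and> \<tau> < t) \<Longrightarrow> f \<tau> = 0" and c: "0 \<le> c" "0 \<le> t"
  shows integrable_bounded_interval: "integrable lborel f"
    and abs_integral_bounded_interval: "\<bar>\<integral>\<tau>. f \<tau> \<partial>lborel\<bar> \<le> c * t"
proof -
  have nn: "(\<integral>\<^sup>+\<tau>. ennreal \<bar>f \<tau>\<bar> \<partial>lborel) \<le> ennreal (c * t)"
    using f f0 c by (intro nn_integral_indicator_le) (auto intro: ennreal_leI)
  show "integrable lborel f"
    by (rule integrableI_bounded) (use order_le_less_trans[OF nn] in simp_all)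
  show "\<bar>\<integral>\<tau>. f \<tau> \<partial>lborel\<bar> \<le> c * t"
    by (rule abs_integral_le_nn_integral[OF nn]) (use c in auto)
qed

lemma u_dyn_eq:
  fixes x :: "'a::euclidean_space \<times> real"
  assumes [measurable]: "\<phi> \<in> borel_measurable borel" "\<psi> \<in> borel_measurable borel"
    and M: "\<And>y. \<bar>\<phi> y\<bar> \<le> M" "\<And>y. \<bar>\<psi> y\<bar> \<le> M"
    and pos: "0 < \<epsilon>" "0 \<le> \<kappa>" "0 < \<delta>" "0 < t" "0 < L" "L \<le> snd x"
  shows "u_dyn \<epsilon> \<kappa> \<delta> \<phi> \<psi> x t = (LINT y:Omega|lborel. G0 x y (t / \<epsilon>) * \<phi> y)
    + (LINT y:Omega|lborel. Hk \<epsilon> \<kappa> \<delta> x y t * \<phi> y) / \<delta>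
    - 2 / \<epsilon> * (\<integral>\<tau>. indicator {0<..<t} \<tau> * (heat \<psi> (fst x) ((t - \<tau>) / \<epsilon> + \<kappa> / \<delta> * \<tau>)
        * dGam1 (snd x + \<tau> / \<delta>) ((t - \<tau>) / \<epsilon>)) \<partial>lborel)"
proof -
  have I: "set_integrable lborel Omega (\<lambda>y. G0 x y (t / \<epsilon>) * \<phi> y)"
    using pos by (intro integrable_G0_Omega[where M = M] M) auto
  have H: "set_integrable lborel Omega (\<lambda>y. (1 / \<delta>) * (Hk \<epsilon> \<kappa> \<delta> x y t * \<phi> y))"
    by (intro set_integrable_mult_right Hk_interior(1)[OF _ M(1) pos]) auto
  have "Gk \<epsilon> \<kappa> \<delta> x y t * \<phi> y = G0 x y (t / \<epsilon>) * \<phi> y + (1 / \<delta>) * (Hk \<epsilon> \<kappa> \<delta> x y t * \<phi> y)" for y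
    by (simp add: Gk_def algebra_simps)
  then have 1: "(LINT y:Omega|lborel. Gk \<epsilon> \<kappa> \<delta> x y t * \<phi> y) = (LINT y:Omega|lborel. G0 x y (t / \<epsilon>) * \<phi> y)
    + (LINT y:Omega|lborel. Hk \<epsilon> \<kappa> \<delta> x y t * \<phi> y) / \<delta>"
    by (simp only: set_integral_add(2)[OF I H] set_integral_mult_right) simp
  have "Gk \<epsilon> \<kappa> \<delta> x (y', 0) t * \<psi> y' = (1 / \<delta>) * (Hk \<epsilon> \<kappa> \<delta> x (y', 0) t * \<psi> y')" for y'
    by (simp add: Gk_def G0_def refl_def)
  then have "\<delta> / \<epsilon> * (\<integral>y'. Gk \<epsilon> \<kappa> \<delta> x (y', 0) t * \<psi> y' \<partial>lborel)
      = 1 / \<epsilon> * (\<integral>y'. Hk \<epsilon> \<kappa> \<delta> x (y', 0) t * \<psi> y' \<partial>lborel)"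
    using pos by simp
  with 1 show ?thesis
    unfolding u_dyn_def by (simp add: Hk_boundary[OF _ M(2) pos])
qed

lemma u_dyn_minus_w_dir:
  fixes \<phi> :: "'a::euclidean_space \<times> real \<Rightarrow> real"
  assumes meas [measurable]: "\<phi> \<in> borel_measurable borel" "\<psi> \<in> borel_measurable borel"
    and M: "\<And>y. \<bar>\<phi> y\<bar> \<le> M" "\<And>y. \<bar>\<psi> y\<bar> \<le> M"
    and pos: "0 < \<epsilon>" "0 \<le> \<kappa>" "0 < L" "0 < T"
  shows "\<exists>C. \<forall>\<delta>>0. \<forall>x\<in>Omega_Lc L. \<forall>t\<in>{0<..<T}.
      \<bar>u_dyn \<epsilon> \<kappa> \<delta> \<phi> \<psi> x t - w_dir \<epsilon> \<phi> \<psi> x t\<bar> \<le> C / \<delta>"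
proof -
  have M0: "0 \<le> M" using M(1)[of undefined] by linarith
  define A where "A = 2 * (M * (256 / L ^ 3) * (T / \<epsilon>) * T)"
  define B where "B = M * (128 / L ^ 3 * T) + M * (2 * DIM('a) * (\<kappa> * T)) * (256 / L ^ 4)"
  have B0: "0 \<le> B" using M0 pos by (simp add: B_def)
  have "\<bar>u_dyn \<epsilon> \<kappa> \<delta> \<phi> \<psi> x t - w_dir \<epsilon> \<phi> \<psi> x t\<bar> \<le> (A + 2 / \<epsilon> * (B * T)) / \<delta>"
    if d: "0 < \<delta>" and x: "x \<in> Omega_Lc L" and t: "t \<in> {0<..<T}" for \<delta> t and x :: "'a \<times> real"
  proof -
    have x': "L \<le> snd x" using x by (auto simp: Omega_Lc_def)
    have t': "0 < t" "t \<le> T" using t by auto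
    note pos' = pos(1,2) d t'(1) pos(3) x'
    define F1 where "F1 \<tau> = indicator {0<..<t} \<tau> * (heat \<psi> (fst x) ((t - \<tau>) / \<epsilon> + \<kappa> / \<delta> * \<tau>)
        * dGam1 (snd x + \<tau> / \<delta>) ((t - \<tau>) / \<epsilon>))" for \<tau>
    define F2 where "F2 \<tau> = indicator {0<..<t} \<tau> * (heat \<psi> (fst x) ((t - \<tau>) / \<epsilon>)
        * dGam1 (snd x) ((t - \<tau>) / \<epsilon>))" for \<tau>
    have F_meas [measurable]: "F1 \<in> borel_measurable borel" "F2 \<in> borel_measurable borel"
      unfolding F1_def F2_def by measurable
    have D: "\<bar>dGam1 \<xi> ((t - \<tau>) / \<epsilon>)\<bar> \<le> 256 / L ^ 4 * (t / \<epsilon>)"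
      if "0 < \<tau>" "\<tau> < t" "L \<le> \<xi>" for \<tau> \<xi>
    proof -
      have "\<bar>dGam1 \<xi> ((t - \<tau>) / \<epsilon>)\<bar> \<le> 256 / L ^ 4 * ((t - \<tau>) / \<epsilon>)"
        using that pos by (intro abs_dGam1_le) auto
      also have "\<dots> \<le> 256 / L ^ 4 * (t / \<epsilon>)"
        using that pos by (intro mult_left_mono divide_right_mono) auto
      finally show ?thesis .
    qed
    have c: "0 \<le> M * (256 / L ^ 4 * (t / \<epsilon>))" using M0 pos t' by auto
    have int: "integrable lborel F1" "integrable lborel F2"
    proof -
      have "\<bar>F1 \<tau>\<bar> \<le> M * (256 / L ^ 4 * (t / \<epsilon>))" if "0 < \<tau>" "\<tau> < t" for \<tau>
      proof -
        have "0 < (t - \<tau>) / \<epsilon> + \<kappa> / \<delta> * \<tau>" using that pos d by (intro add_pos_nonneg) auto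
        moreover have "0 < \<tau> / \<delta>" using that d by simp
        ultimately show ?thesis
          using that x' unfolding F1_def
          by (simp add: abs_mult del: times_divide_eq_right times_divide_eq_left)
            (intro mult_mono abs_heat_le M D M0, auto)
      qed
      then show "integrable lborel F1"
        using c t' by (intro integrable_bounded_interval[where t = t and c = "M * (256 / L ^ 4 * (t / \<epsilon>))"]) (auto simp: F1_def)
      have "\<bar>F2 \<tau>\<bar> \<le> M * (256 / L ^ 4 * (t / \<epsilon>))" if "0 < \<tau>" "\<tau> < t" for \<tau>
      proof -
        have "0 < (t - \<tau>) / \<epsilon>" using that pos by auto
        then show ?thesis
          using that x' unfolding F2_def
          by (simp add: abs_mult del: times_divide_eq_right times_divide_eq_left)
            (intro mult_mono abs_heat_le M D M0, auto)
      qed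
      then show "integrable lborel F2"
        using c t' by (intro integrable_bounded_interval[where t = t and c = "M * (256 / L ^ 4 * (t / \<epsilon>))"]) (auto simp: F2_def)
    qed
    have "\<bar>\<integral>\<tau>. F1 \<tau> - F2 \<tau> \<partial>lborel\<bar> \<le> B / \<delta> * t"
    proof (rule abs_integral_bounded_interval)
      fix \<tau> assume \<tau>: "0 < \<tau>" "\<tau> < t"
      define s where "s = (t - \<tau>) / \<epsilon>"
      define h where "h = \<tau> / \<delta>"
      have s: "0 < s" using \<tau> pos by (auto simp: s_def)
      have h: "0 \<le> h" "h \<le> T / \<delta>" using \<tau> d t' by (auto simp: h_def divide_right_mono)
      have kh: "0 \<le> \<kappa> * h" "\<kappa> * h \<le> \<kappa> * (T / \<delta>)" using h pos by (simp, intro mult_left_mono) auto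
      let ?h2 = "heat \<psi> (fst x) (s + \<kappa> * h)" and ?h1 = "heat \<psi> (fst x) s"
      let ?d2 = "dGam1 (snd x + h) s" and ?d1 = "dGam1 (snd x) s"
      have "F1 \<tau> - F2 \<tau> = ?h2 * (?d2 - ?d1) + (?h2 - ?h1) * ?d1"
        using \<tau> by (simp add: F1_def F2_def s_def h_def algebra_simps)
      then have "\<bar>F1 \<tau> - F2 \<tau>\<bar> \<le> \<bar>?h2\<bar> * \<bar>?d2 - ?d1\<bar> + \<bar>?h2 - ?h1\<bar> * \<bar>?d1\<bar>"
        by (metis abs_mult abs_triangle_ineq)
      also have "\<bar>?h2\<bar> * \<bar>?d2 - ?d1\<bar> \<le> M * (128 / L ^ 3 * (T / \<delta>))"
      proof (rule mult_mono)
        show "\<bar>?h2\<bar> \<le> M" using s kh by (intro abs_heat_le M) auto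
        have "\<bar>?d2 - ?d1\<bar> \<le> 128 / L ^ 3 * h" using s pos x' h by (intro dGam1_lipschitz) auto
        also have "\<dots> \<le> 128 / L ^ 3 * (T / \<delta>)" using h pos by (intro mult_left_mono) auto
        finally show "\<bar>?d2 - ?d1\<bar> \<le> 128 / L ^ 3 * (T / \<delta>)" .
      qed (use M0 in auto)
      also have "\<bar>?h2 - ?h1\<bar> * \<bar>?d1\<bar> \<le> M * (2 * DIM('a) * (\<kappa> * (T / \<delta>))) * (256 / L ^ 4)"
      proof -
        have "\<bar>?h2 - ?h1\<bar> \<le> M * (2 * DIM('a) * (s + \<kappa> * h - s) / (s + \<kappa> * h))"
          using s kh by (intro heat_diff_le M) auto
        also have "\<dots> \<le> M * (2 * DIM('a) * (\<kappa> * (T / \<delta>)) / s)"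
          using s kh M0 pos d by (intro mult_left_mono frac_le) auto
        finally have "\<bar>?h2 - ?h1\<bar> * \<bar>?d1\<bar>
            \<le> M * (2 * DIM('a) * (\<kappa> * (T / \<delta>)) / s) * (256 / L ^ 4 * s)"
          using s pos d x' M0 order_trans[OF kh]
          by (intro mult_mono abs_dGam1_le) auto
        also have "\<dots> = M * (2 * DIM('a) * (\<kappa> * (T / \<delta>))) * (256 / L ^ 4)"
          using s by simp
        finally show ?thesis .
      qed
      finally show "\<bar>F1 \<tau> - F2 \<tau>\<bar> \<le> B / \<delta>"
        using d by (simp add: B_def add_divide_distrib mult_ac)
    qed (use B0 d t' in \<open>auto simp: F1_def F2_def\<close>)
    also have "\<dots> \<le> B / \<delta> * T" using B0 d t' by (intro mult_left_mono) auto
    finally have 1: "\<bar>(\<integral>\<tau>. F1 \<tau> \<partial>lborel) - (\<integral>\<tau>. F2 \<tau> \<partial>lborel)\<bar> \<le> B / \<delta> * T"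
      using int by simp
    let ?H = "LINT y:Omega|lborel. Hk \<epsilon> \<kappa> \<delta> x y t * \<phi> y"
    have "\<bar>?H\<bar> \<le> 2 * (M * (256 / L ^ 3) * (t / \<epsilon>) * t)"
      by (rule Hk_interior(2)[OF meas(1) M(1) pos'])
    also have "\<dots> \<le> A" unfolding A_def
      using M0 pos t' by (intro mult_left_mono mult_mono divide_right_mono) auto
    finally have 2: "\<bar>?H\<bar> \<le> A" .
    have tri: "\<bar>p / \<delta> + (- (2 / \<epsilon>)) * q\<bar> \<le> \<bar>p\<bar> / \<delta> + 2 / \<epsilon> * \<bar>q\<bar>" for p q :: real
      using abs_triangle_ineq[of "p / \<delta>" "(- (2 / \<epsilon>)) * q"] pos d by (simp add: abs_mult)
    have "u_dyn \<epsilon> \<kappa> \<delta> \<phi> \<psi> x t - w_dir \<epsilon> \<phi> \<psi> x t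
        = ?H / \<delta> + (- (2 / \<epsilon>)) * ((\<integral>\<tau>. F1 \<tau> \<partial>lborel) - (\<integral>\<tau>. F2 \<tau> \<partial>lborel))"
      unfolding u_dyn_eq[OF meas M pos'] w_dir_eq[OF less_imp_le[OF t'(1)]] F1_def F2_def
      by (simp add: algebra_simps)
    also have "\<bar>\<dots>\<bar> \<le> \<bar>?H\<bar> / \<delta> + 2 / \<epsilon> * \<bar>(\<integral>\<tau>. F1 \<tau> \<partial>lborel) - (\<integral>\<tau>. F2 \<tau> \<partial>lborel)\<bar>"
      by (rule tri)
    also have "\<dots> \<le> A / \<delta> + 2 / \<epsilon> * (B / \<delta> * T)"
      using 1 2 d pos by (intro add_mono divide_right_mono mult_left_mono) auto
    also have "\<dots> = (A + 2 / \<epsilon> * (B * T)) / \<delta>" by (simp add: add_divide_distrib)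
    finally show ?thesis .
  qed
  then show ?thesis by blast
qed

section \<open>Convergence to the Poisson integral\<close>

lemma dGam1_eq: "- 2 * dGam1 \<xi> s = \<xi> / s * Gam 1 \<xi> s"
  by (simp add: dGam1_def)

lemma nn_integral_Gam_over_time:
  assumes n: "0 < n" and r: "0 < r"
  shows "(\<integral>\<^sup>+s. ennreal (indicator {0<..} s * (Gam n r s / s)) \<partial>lborel)
    = ennreal (pi powr (- real n / 2) * Gamma (real n / 2) * r powr (- real n))"
proof -
  let ?f = "\<lambda>s. Gam n r s / s" and ?g = "\<lambda>v. r\<^sup>2 / (4 * v)" and ?g' = "\<lambda>v. - (r\<^sup>2 / (4 * v\<^sup>2))"
  let ?c = "pi powr (- real n / 2) * r powr (- real n)"
  have n2: "0 < real n / 2" using n by simp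
  have "((\<lambda>v. if v \<in> {0<..} then v powr (real n / 2 - 1) / exp v else 0) has_integral Gamma (real n / 2)) {0..}"
    by (rule has_integral_spike[of "{0}", OF _ _ Gamma_integral_real[OF n2]]) auto
  then have "((\<lambda>v. v powr (real n / 2 - 1) / exp v) has_integral Gamma (real n / 2)) {0<..}"
    by (subst (asm) has_integral_restrict) auto
  then have "((\<lambda>v. ?c * (v powr (real n / 2 - 1) / exp v)) has_integral ?c * Gamma (real n / 2)) {0<..}"
    by (rule has_integral_mult_right)
  moreover have eq: "?c * (v powr (real n / 2 - 1) / exp v) = \<bar>?g' v\<bar> * ?f (?g v)" if "v \<in> {0<..}" for v
  proof -
    have v: "0 < v" using that by simp
    have "(4 * pi * ?g v) powr (- real n / 2) = (pi * (r\<^sup>2 / v)) powr (- real n / 2)"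
      by (simp add: field_simps)
    also have "\<dots> = pi powr (- real n / 2) * ((r\<^sup>2) powr (- real n / 2) / v powr (- real n / 2))"
      by (simp add: powr_mult powr_divide)
    also have "(r\<^sup>2) powr (- real n / 2) = r powr (- real n)"
      using r by (simp add: powr_powr powr_numeral[symmetric] del: powr_numeral)
    also have "v powr (- real n / 2) = 1 / v powr (real n / 2)"
      by (simp add: powr_minus_divide)
    finally have 1: "(4 * pi * ?g v) powr (- real n / 2) = ?c * v powr (real n / 2)" by simp
    have "- r\<^sup>2 / (4 * ?g v) = - v" using r v by simp
    then have 2: "Gam n r (?g v) = ?c * v powr (real n / 2) * exp (- v)"
      unfolding Gam_def 1 by simp
    have pw: "v powr (real n / 2 - 1) = v powr (real n / 2) / v"
      using v by (subst powr_diff) simp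
    have 3: "\<bar>?g' v\<bar> / ?g v = 1 / v" using r v by (simp add: power2_eq_square)
    have "\<bar>?g' v\<bar> * ?f (?g v) = (\<bar>?g' v\<bar> / ?g v) * Gam n r (?g v)" by simp
    also have "\<dots> = ?c * (v powr (real n / 2) / v * exp (- v))" unfolding 2 3 by simp
    also have "\<dots> = ?c * (v powr (real n / 2 - 1) / exp v)"
      using v by (simp add: pw exp_minus inverse_eq_divide)
    finally show ?thesis ..
  qed
  ultimately have "((\<lambda>v. \<bar>?g' v\<bar> * ?f (?g v)) has_integral ?c * Gamma (real n / 2)) {0<..}"
    by (rule has_integral_eq[rotated])
  then have "(\<lambda>v. \<bar>?g' v\<bar> * ?f (?g v)) absolutely_integrable_on {0<..} \<and>
      integral {0<..} (\<lambda>v. \<bar>?g' v\<bar> * ?f (?g v)) = ?c * Gamma (real n / 2)"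
    using r by (auto intro!: nonnegative_absolutely_integrable_1 simp: integral_unique has_integral_integrable)
  moreover have "inj_on ?g {0<..}" using r by (auto simp: inj_on_def)
  moreover have "(?g has_field_derivative ?g' v) (at v within {0<..})" if "v \<in> {0<..}" for v
    using that by (auto intro!: derivative_eq_intros simp: power2_eq_square)
  ultimately have *: "?f absolutely_integrable_on ?g ` {0<..} \<and>
      integral (?g ` {0<..}) ?f = ?c * Gamma (real n / 2)"
    using has_absolute_integral_change_of_variables_1'[of "{0<..}" ?g ?g' ?f "?c * Gamma (real n / 2)"]
    by auto
  have img: "?g ` {0<..} = {0<..}"
  proof (intro equalityI subsetI)
    fix s :: real assume "s \<in> {0<..}"
    then show "s \<in> ?g ` {0<..}" using r by (intro image_eqI[of _ _ "r\<^sup>2 / (4 * s)"]) auto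
  qed (use r in auto)
  have "(?f has_integral ?c * Gamma (real n / 2)) {0<..}"
    using * unfolding img by (metis has_integral_integral set_lebesgue_integral_eq_integral(1))
  then show ?thesis
    by (subst nn_integral_has_integral_lebesgue[where I = "?c * Gamma (real n / 2)"]) (auto simp: mult_ac)
qed

lemma abs_integral_G0_le:
  fixes x :: "'a::euclidean_space \<times> real"
  assumes M: "\<And>y. \<bar>\<phi> y\<bar> \<le> M" and s: "0 < s" and x: "0 \<le> snd x"
  shows "\<bar>LINT y:Omega|lborel. G0 x y s * \<phi> y\<bar> \<le> M * (2 * snd x / sqrt s)"
proof -
  define b where "b = snd x"
  have b: "0 \<le> b" using x by (simp add: b_def)
  have M0: "0 \<le> M" using M[of undefined] by linarith
  define g where "g \<eta> = M * (indicator {0<..} \<eta> * (Gam 1 (b - \<eta>) s - Gam 1 (b + \<eta>) s))" for \<eta>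
  have [measurable]: "g \<in> borel_measurable borel" unfolding g_def by measurable
  have mono: "Gam 1 (b + \<eta>) s \<le> Gam 1 (b - \<eta>) s" if "0 < \<eta>" for \<eta>
  proof -
    have "(b - \<eta>)\<^sup>2 \<le> (b + \<eta>)\<^sup>2" using that b by (simp add: power2_eq_square algebra_simps)
    then show ?thesis using s by (auto simp: Gam_def intro!: mult_left_mono divide_right_mono)
  qed
  have g0: "0 \<le> g \<eta>" for \<eta> using M0 mono[of \<eta>] by (auto simp: g_def indicator_def)
  have int1: "integrable lborel (\<lambda>\<eta>. Gam 1 (c - \<eta>) s)" for c
    using integrable_Gam[OF s, of c] by (simp add: Gam_def)
  have intA: "integrable lborel (\<lambda>\<eta>. indicator A \<eta> * Gam 1 (c - \<eta>) s)" if "A \<in> sets borel" for A c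
    using integrable_mult_indicator[OF _ int1[of c], of A] that by simp
  have int0: "integrable lborel (\<lambda>\<eta>. indicator A \<eta> * Gam 1 \<eta> s)" if "A \<in> sets borel" for A
    using intA[OF that, of 0] by simp
  have intB: "integrable lborel (\<lambda>\<eta>. indicator {0<..} \<eta> * Gam 1 (b + \<eta>) s)"
    using intA[of "{0<..}" "- b"] Gam_minus[of 1 "b + _" s] by simp
  have int_g: "integrable lborel g"
    unfolding g_def right_diff_distrib using intA[of "{0<..}" b] intB by (intro integrable_mult_right Bochner_Integration.integrable_diff) auto
  have "(\<integral>\<eta>. g \<eta> \<partial>lborel) = M * ((\<integral>\<eta>. indicator {0<..} \<eta> * Gam 1 (b - \<eta>) s \<partial>lborel)
      - (\<integral>\<eta>. indicator {0<..} \<eta> * Gam 1 (b + \<eta>) s \<partial>lborel))"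
    unfolding g_def right_diff_distrib[of "indicator _ _"] using intA[of "{0<..}" b] intB by simp
  also have "(\<integral>\<eta>. indicator {0<..} \<eta> * Gam 1 (b - \<eta>) s \<partial>lborel)
      = (\<integral>\<xi>. indicator {..<b} \<xi> * Gam 1 \<xi> s \<partial>lborel)"
    by (subst lborel_integral_real_affine[of "-1" _ b])
      (auto intro!: Bochner_Integration.integral_cong simp: indicator_def)
  also have "(\<integral>\<eta>. indicator {0<..} \<eta> * Gam 1 (b + \<eta>) s \<partial>lborel)
      = (\<integral>\<xi>. indicator {..<-b} \<xi> * Gam 1 \<xi> s \<partial>lborel)"
    by (subst lborel_integral_real_affine[of "-1" _ "- b"])
      (auto intro!: Bochner_Integration.integral_cong simp: indicator_def)
  also have "(\<integral>\<xi>. indicator {..<b} \<xi> * Gam 1 \<xi> s \<partial>lborel) - (\<integral>\<xi>. indicator {..<-b} \<xi> * Gam 1 \<xi> s \<partial>lborel)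
      = (\<integral>\<xi>. indicator {..<b} \<xi> * Gam 1 \<xi> s - indicator {..<-b} \<xi> * Gam 1 \<xi> s \<partial>lborel)"
    by (rule Bochner_Integration.integral_diff[symmetric]; rule int0; simp)
  also have "\<dots> = (\<integral>\<xi>. indicator {-b..<b} \<xi> * Gam 1 \<xi> s \<partial>lborel)"
    using b by (intro Bochner_Integration.integral_cong) (auto simp: indicator_def)
  also have "\<dots> \<le> (\<integral>\<xi>. indicator {-b..<b} \<xi> * (1 / sqrt s) \<partial>lborel)"
  proof (rule integral_mono)
    show "indicator {-b..<b} \<xi> * Gam 1 \<xi> s \<le> indicator {-b..<b} \<xi> * (1 / sqrt s)" for \<xi>
    proof (rule mult_left_mono)
      have "1 * s \<le> 4 * pi * s" using s pi_ge_two by (intro mult_right_mono) auto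
      then show "Gam 1 \<xi> s \<le> 1 / sqrt s"
        unfolding Gam_1[OF s] using s by (intro frac_le) auto
    qed auto
    show "integrable lborel (\<lambda>\<xi>. indicator {-b..<b} \<xi> * Gam 1 \<xi> s)" by (rule int0) simp
    show "integrable lborel (\<lambda>\<xi>. indicator {-b..<b} \<xi> * (1 / sqrt s))" using b by simp
  qed
  also have "\<dots> = 2 * b / sqrt s" using b by simp
  finally have g_le: "(\<integral>\<eta>. g \<eta> \<partial>lborel) \<le> M * (2 * b / sqrt s)" using M0 by (simp add: mult_left_mono)
  have "(\<integral>\<^sup>+y. ennreal \<bar>indicator Omega y * (G0 x y s * \<phi> y)\<bar> \<partial>lborel)
      \<le> (\<integral>\<^sup>+y. ennreal \<bar>Gam DIM('a) (norm (fst x - fst y)) s * g (snd y)\<bar> \<partial>lborel)"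
  proof (intro nn_integral_mono ennreal_leI)
    fix y :: "'a \<times> real"
    have "indicator Omega y * G0 x y s * M = Gam DIM('a) (norm (fst x - fst y)) s * g (snd y)"
      unfolding G0_def Gam_half_space(2)[OF s] unfolding Gam_half_space(1)[OF s] g_def b_def
      by (cases y) (simp add: Omega_def indicator_def algebra_simps)
    moreover have "\<bar>indicator Omega y * (G0 x y s * \<phi> y)\<bar> \<le> \<bar>indicator Omega y * G0 x y s * M\<bar>"
      using M[of y] M0 by (auto simp: abs_mult indicator_def intro!: mult_left_mono)
    ultimately show "\<bar>indicator Omega y * (G0 x y s * \<phi> y)\<bar>
        \<le> \<bar>Gam DIM('a) (norm (fst x - fst y)) s * g (snd y)\<bar>" by simp
  qed
  also have "\<dots> = (\<integral>\<^sup>+\<eta>. ennreal (g \<eta>) \<partial>lborel)"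
    by (subst nn_integral_Gam_prod[OF s]) (use g0 in auto)
  also have "\<dots> \<le> ennreal (M * (2 * b / sqrt s))"
    using g0 g_le by (subst nn_integral_eq_integral[OF int_g]) (auto intro: ennreal_leI)
  finally show ?thesis
    unfolding set_lebesgue_integral_def real_scaleR_def b_def
    by (rule abs_integral_le_nn_integral) (use M0 s x in auto)
qed

lemma w_dir_boundary_eq:
  assumes "0 < \<epsilon>"
  shows "- (2 / \<epsilon>) * (\<integral>\<tau>. indicator {0<..<t} \<tau> *
      (heat \<psi> a ((t - \<tau>) / \<epsilon>) * dGam1 b ((t - \<tau>) / \<epsilon>)) \<partial>lborel)
    = (\<integral>s. indicator {0<..<t / \<epsilon>} s * (b / s * Gam 1 b s * heat \<psi> a s) \<partial>lborel)"
proof -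
  have "(\<integral>\<tau>. indicator {0<..<t} \<tau> * (heat \<psi> a ((t - \<tau>) / \<epsilon>) * dGam1 b ((t - \<tau>) / \<epsilon>)) \<partial>lborel)
      = \<epsilon> * (\<integral>s. indicator {0<..<t} (t - \<epsilon> * s) * (heat \<psi> a s * dGam1 b s) \<partial>lborel)"
    using assms by (subst lborel_integral_real_affine[of "- \<epsilon>" _ t]) auto
  also have "(\<lambda>s. indicator {0<..<t} (t - \<epsilon> * s) :: real) = indicator {0<..<t / \<epsilon>}"
    using assms by (auto simp: indicator_def fun_eq_iff field_simps zero_less_mult_iff)
  finally have "- (2 / \<epsilon>) * (\<integral>\<tau>. indicator {0<..<t} \<tau> *
        (heat \<psi> a ((t - \<tau>) / \<epsilon>) * dGam1 b ((t - \<tau>) / \<epsilon>)) \<partial>lborel)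
      = - 2 * (\<integral>s. indicator {0<..<t / \<epsilon>} s * (heat \<psi> a s * dGam1 b s) \<partial>lborel)"
    using assms by simp
  also have "\<dots> = (\<integral>s. - 2 * (indicator {0<..<t / \<epsilon>} s * (heat \<psi> a s * dGam1 b s)) \<partial>lborel)"
    by (rule integral_mult_right_zero[symmetric])
  also have "\<dots> = (\<integral>s. indicator {0<..<t / \<epsilon>} s * (b / s * Gam 1 b s * heat \<psi> a s) \<partial>lborel)"
    unfolding dGam1_eq[symmetric] by (simp only: mult_ac)
  finally show ?thesis .
qed

lemma nn_integral_time_kernel:
  fixes b :: real
  assumes "0 < b"
  shows "(\<integral>\<^sup>+s. ennreal (indicator {0<..} s * (b / s * Gam 1 b s)) \<partial>lborel) = 1"
proof -
  have "(\<integral>\<^sup>+s. ennreal (indicator {0<..} s * (b / s * Gam 1 b s)) \<partial>lborel)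
      = (\<integral>\<^sup>+s. ennreal b * ennreal (indicator {0<..} s * (Gam 1 b s / s)) \<partial>lborel)"
    using assms by (intro nn_integral_cong) (auto simp: ennreal_mult[symmetric] indicator_def)
  also have "\<dots> = ennreal b * ennreal (pi powr (- real 1 / 2) * Gamma (real 1 / 2) * b powr (- real 1))"
    using nn_integral_Gam_over_time[OF _ assms, of 1] by (simp add: nn_integral_cmult)
  also have "\<dots> = 1"
    using assms by (simp add: ennreal_mult[symmetric] Gamma_one_half_real powr_minus powr_half_sqrt)
  finally show ?thesis .
qed

lemma Pker_eq:
  fixes z :: "'a::euclidean_space"
  assumes b: "0 < b"
  shows "Pker z b = (\<integral>s. indicator {0<..} s * (b / s * Gam 1 b s) * Gam DIM('a) (norm z) s \<partial>lborel)"
proof -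
  let ?c = "pi powr (- real (DIM('a) + 1) / 2) * Gamma (real (DIM('a) + 1) / 2)
      * norm (z, b) powr (- real (DIM('a) + 1))"
  have r: "0 < norm (z, b)" using b by (simp add: zero_prod_def)
  have "has_bochner_integral lborel (\<lambda>s. indicator {0<..} s * (Gam (DIM('a) + 1) (norm (z, b)) s / s)) ?c"
    by (rule has_bochner_integral_nn_integral)
      (use nn_integral_Gam_over_time[OF _ r, of "DIM('a) + 1"] in \<open>auto simp: indicator_def\<close>)
  then have "b * ?c = (\<integral>s. b * (indicator {0<..} s * (Gam (DIM('a) + 1) (norm (z, b)) s / s)) \<partial>lborel)"
    unfolding integral_mult_right_zero by (simp only: has_bochner_integral_integral_eq)
  also have "\<dots> = (\<integral>s. indicator {0<..} s * (b / s * Gam 1 b s) * Gam DIM('a) (norm z) s \<partial>lborel)"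
    by (intro Bochner_Integration.integral_cong)
      (auto simp: indicator_def Gam_prod[simplified])
  finally show ?thesis by (simp only: Pker_def Let_def mult_ac)
qed

lemma
  fixes a :: "'a::euclidean_space"
  assumes [measurable]: "\<psi> \<in> borel_measurable borel" and M: "\<And>y. \<bar>\<psi> y\<bar> \<le> M" and b: "0 < b"
  shows U_harm_eq: "U_harm \<psi> (a, b) = (\<integral>s. indicator {0<..} s * (b / s * Gam 1 b s * heat \<psi> a s) \<partial>lborel)"
    and integrable_time_kernel_heat:
      "integrable lborel (\<lambda>s. indicator {0<..} s * (b / s * Gam 1 b s * heat \<psi> a s))"
proof -
  define k where "k s = indicator {0<..} s * (b / s * Gam 1 b s)" for s
  define f where "f s y = k s * Gam DIM('a) (norm (a - y)) s * \<psi> y" for s y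
  have [measurable]: "k \<in> borel_measurable borel" unfolding k_def by measurable
  have M0: "0 \<le> M" using M[of undefined] by linarith
  have k0: "0 \<le> k s" for s using b by (auto simp: k_def indicator_def)
  have meas: "case_prod f \<in> borel_measurable (lborel \<Otimes>\<^sub>M lborel)"
    unfolding f_def by measurable
  have f_le: "(\<integral>\<^sup>+y. ennreal \<bar>f s y\<bar> \<partial>lborel) \<le> ennreal (k s) * ennreal M" for s
  proof (cases "0 < s")
    case True
    have "(\<integral>\<^sup>+y. ennreal \<bar>f s y\<bar> \<partial>lborel)
        = (\<integral>\<^sup>+y. ennreal (k s) * ennreal \<bar>Gam DIM('a) (norm (a - y)) s * \<psi> y\<bar> \<partial>lborel)"
      using k0 by (simp add: f_def abs_mult ennreal_mult[symmetric] mult_ac)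
    also have "\<dots> = ennreal (k s) * (\<integral>\<^sup>+y. ennreal \<bar>Gam DIM('a) (norm (a - y)) s * \<psi> y\<bar> \<partial>lborel)"
      by (rule nn_integral_cmult) measurable
    also have "\<dots> \<le> ennreal (k s) * ennreal M"
      by (intro mult_left_mono nn_integral_Gam_mult_le True M) auto
    finally show ?thesis .
  qed (simp add: f_def k_def)
  have nn_k: "(\<integral>\<^sup>+s. ennreal (k s) * ennreal M \<partial>lborel) = ennreal M"
    using nn_integral_time_kernel[OF b] by (simp add: nn_integral_multc k_def)
  have bound: "(\<integral>\<^sup>+s. \<integral>\<^sup>+y. ennreal \<bar>f s y\<bar> \<partial>lborel \<partial>lborel) \<le> ennreal M"
    using nn_integral_mono[of lborel "\<lambda>s. \<integral>\<^sup>+y. ennreal \<bar>f s y\<bar> \<partial>lborel", OF f_le] nn_k by simp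
  have inner: "(\<integral>y. f s y \<partial>lborel) = indicator {0<..} s * (b / s * Gam 1 b s * heat \<psi> a s)" for s
    unfolding f_def heat_def integral_mult_right_zero[symmetric] k_def by (simp add: mult_ac)
  have "U_harm \<psi> (a, b) = (\<integral>y. \<integral>s. f s y \<partial>lborel \<partial>lborel)"
    unfolding U_harm_def fst_conv snd_conv Pker_eq[OF b] f_def k_def integral_mult_left_zero ..
  also have "\<dots> = (\<integral>s. \<integral>y. f s y \<partial>lborel \<partial>lborel)"
    by (rule Fubini_bounded[OF meas bound M0])
  finally show "U_harm \<psi> (a, b) = (\<integral>s. indicator {0<..} s * (b / s * Gam 1 b s * heat \<psi> a s) \<partial>lborel)"
    unfolding inner .
  show "integrable lborel (\<lambda>s. indicator {0<..} s * (b / s * Gam 1 b s * heat \<psi> a s))"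
  proof (rule integrableI_bounded)
    have "ennreal (norm (indicator {0<..} s * (b / s * Gam 1 b s * heat \<psi> a s))) \<le> ennreal (k s) * ennreal M" for s
    proof (cases "0 < s")
      case True
      then have "\<bar>heat \<psi> a s\<bar> \<le> M" by (intro abs_heat_le M)
      then have "\<bar>k s * heat \<psi> a s\<bar> \<le> k s * M" using k0[of s] by (auto simp: abs_mult intro: mult_left_mono)
      then show ?thesis using True k0[of s] M0
        by (simp add: k_def ennreal_mult[symmetric] ennreal_leI mult.assoc)
    qed simp
    then have "(\<integral>\<^sup>+s. ennreal (norm (indicator {0<..} s * (b / s * Gam 1 b s * heat \<psi> a s))) \<partial>lborel) \<le> ennreal M"
      using nn_integral_mono[of lborel _ "\<lambda>s. ennreal (k s) * ennreal M"] nn_k by simp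
    then show "(\<integral>\<^sup>+s. ennreal (norm (indicator {0<..} s * (b / s * Gam 1 b s * heat \<psi> a s))) \<partial>lborel) < \<infinity>"
      by (rule order_le_less_trans) simp
  qed measurable
qed

lemma w_dir_minus_U_harm:
  fixes \<phi> :: "'a::euclidean_space \<times> real \<Rightarrow> real"
  assumes [measurable]: "\<psi> \<in> borel_measurable borel"
    and M: "\<And>y. \<bar>\<phi> y\<bar> \<le> M" "\<And>y. \<bar>\<psi> y\<bar> \<le> M"
    and pos: "0 < \<epsilon>" "0 < T" and x: "x \<in> Omega_L L" and t: "T \<le> t"
  shows "\<bar>w_dir \<epsilon> \<phi> \<psi> x t - U_harm \<psi> x\<bar> \<le> 4 * M * L / sqrt T * sqrt \<epsilon>"
proof -
  obtain a b where ab: "x = (a, b)" "0 \<le> b" "b \<le> L" using x by (auto simp: Omega_L_def)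
  have M0: "0 \<le> M" using M(1)[of undefined] by linarith
  define A where "A = t / \<epsilon>"
  have A: "0 < A" "0 \<le> t" using pos t by (auto simp: A_def)
  have w: "w_dir \<epsilon> \<phi> \<psi> x t = (LINT y:Omega|lborel. G0 x y A * \<phi> y)
      + (\<integral>s. indicator {0<..<A} s * (b / s * Gam 1 b s * heat \<psi> a s) \<partial>lborel)"
    using w_dir_boundary_eq[OF pos(1), of t \<psi> a b]
    by (simp add: w_dir_eq[OF A(2)] ab A_def)
  have 1: "\<bar>LINT y:Omega|lborel. G0 x y A * \<phi> y\<bar> \<le> M * (2 * b / sqrt A)"
    using abs_integral_G0_le[OF M(1) A(1), of x] ab by simp
  have 2: "\<bar>(\<integral>s. indicator {0<..<A} s * (b / s * Gam 1 b s * heat \<psi> a s) \<partial>lborel) - U_harm \<psi> x\<bar>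
      \<le> M * (2 * b / sqrt A)"
  proof (cases "b = 0")
    case True
    then show ?thesis by (simp add: ab U_harm_def Pker_def)
  next
    case False
    then have b: "0 < b" using ab by simp
    let ?q = "\<lambda>s. b / s * Gam 1 b s * heat \<psi> a s"
    have i: "integrable lborel (\<lambda>s. indicator {0<..} s * ?q s)"
      by (rule integrable_time_kernel_heat[OF _ M(2) b]) simp
    have "integrable lborel (\<lambda>s. indicator {0<..<A} s *\<^sub>R (indicator {0<..} s * ?q s))"
      by (rule integrable_mult_indicator[OF _ i]) simp
    moreover have "indicator {0<..<A} s *\<^sub>R (indicator {0<..} s * ?q s) = indicator {0<..<A} s * ?q s" for s
      by (simp add: indicator_def)
    ultimately have i': "integrable lborel (\<lambda>s. indicator {0<..<A} s * ?q s)" by (simp only:)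
    have "(\<integral>s. indicator {0<..} s * ?q s \<partial>lborel) - (\<integral>s. indicator {0<..<A} s * ?q s \<partial>lborel)
        = (\<integral>s. indicator {A..} s * ?q s \<partial>lborel)"
      using A by (subst Bochner_Integration.integral_diff[OF i i', symmetric])
        (auto intro!: Bochner_Integration.integral_cong simp: indicator_def)
    also have "\<bar>\<dots>\<bar> \<le> M * (2 * b / sqrt A)"
    proof (rule abs_integral_le_nn_integral)
      have "\<bar>indicator {A..} s * ?q s\<bar> \<le> indicator {A..} s * (M * b * s powr (- 3 / 2))" for s
      proof (cases "A \<le> s")
        case True
        then have s: "0 < s" using A by simp
        have "1 * s \<le> 4 * pi * s" using s pi_ge_two by (intro mult_right_mono) auto
        then have "Gam 1 b s \<le> 1 / sqrt s"
          unfolding Gam_1[OF s] using s by (intro frac_le) auto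
        then have "b / s * Gam 1 b s * \<bar>heat \<psi> a s\<bar> \<le> b / s * (1 / sqrt s) * M"
          using s b by (intro mult_mono mult_left_mono abs_heat_le M) auto
        also have "1 / s * (1 / sqrt s) = s powr (- 3 / 2)"
        proof -
          have "s powr (- 3 / 2) = s powr (- 1 + - (1 / 2))" by simp
          also have "\<dots> = s powr (- 1) * s powr (- (1 / 2))" by (rule powr_add)
          also have "\<dots> = 1 / s * (1 / sqrt s)"
            using s by (simp add: powr_minus_divide powr_half_sqrt)
          finally show ?thesis ..
        qed
        then have "b / s * (1 / sqrt s) * M = M * b * s powr (- 3 / 2)"
          by (metis (no_types, lifting) mult.assoc mult.commute times_divide_eq_right mult.right_neutral)
        finally show ?thesis using True b s by (simp add: abs_mult)
      qed simp
      then have "(\<integral>\<^sup>+s. ennreal \<bar>indicator {A..} s * ?q s\<bar> \<partial>lborel)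
          \<le> (\<integral>\<^sup>+s. ennreal (indicator {A..} s * (M * b * s powr (- 3 / 2))) \<partial>lborel)"
        by (intro nn_integral_mono ennreal_leI)
      also have "\<dots> = ennreal (M * b * (- (A powr (- 3 / 2 + 1)) / (- 3 / 2 + 1)))"
        by (intro nn_integral_has_integral_lebesgue has_integral_mult_right has_integral_powr_to_inf)
          (use A b M0 in auto)
      also have "M * b * (- (A powr (- 3 / 2 + 1)) / (- 3 / 2 + 1)) = M * (2 * b / sqrt A)"
        using A by (simp add: powr_minus_divide powr_half_sqrt)
      finally show "(\<integral>\<^sup>+s. ennreal \<bar>indicator {A..} s * ?q s\<bar> \<partial>lborel) \<le> ennreal (M * (2 * b / sqrt A))" .
    qed (use M0 A b in auto)
    finally show ?thesis
      unfolding ab U_harm_eq[OF assms(1) M(2) b] by (simp add: abs_minus_commute)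
  qed
  have "\<bar>w_dir \<epsilon> \<phi> \<psi> x t - U_harm \<psi> x\<bar> \<le> M * (2 * b / sqrt A) + M * (2 * b / sqrt A)"
    using 1 2 unfolding w by linarith
  also have "\<dots> = 4 * M * b / sqrt t * sqrt \<epsilon>" by (simp add: A_def real_sqrt_divide)
  also have "\<dots> \<le> 4 * M * L / sqrt T * sqrt \<epsilon>"
    using ab M0 pos t by (intro mult_right_mono frac_le mult_left_mono) auto
  finally show ?thesis .
qed

section \<open>Convergence to the initial datum\<close>

lemma Gam_tail_le:
  assumes s: "0 < s" and r: "0 < r" "r \<le> \<bar>\<rho>\<bar>"
  shows "Gam d \<rho> s \<le> 2 powr (d / 2) * (8 * s / r\<^sup>2) * Gam d \<rho> (2 * s)"
proof -
  have "r\<^sup>2 \<le> \<rho>\<^sup>2" using r power_mono[of r "\<bar>\<rho>\<bar>" 2] by simp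
  then have "exp (- \<rho>\<^sup>2 / (8 * s)) \<le> exp (- (r\<^sup>2 / (8 * s)))"
    using s by (simp add: divide_right_mono)
  also have "\<dots> \<le> 8 * s / r\<^sup>2"
    using exp_minus_le_inverse[of "r\<^sup>2 / (8 * s)"] s r by simp
  finally show ?thesis
    unfolding Gam_double[OF s] by (intro mult_right_mono mult_left_mono) auto
qed

lemma G0_approximates_identity:
  fixes x :: "'a::euclidean_space \<times> real" and \<phi> :: "'a \<times> real \<Rightarrow> real"
  assumes [measurable]: "\<phi> \<in> borel_measurable borel" and M: "\<And>y. \<bar>\<phi> y\<bar> \<le> M"
    and r: "0 < r" "ball x r \<subseteq> Omega" and e: "\<And>y. y \<in> ball x r \<Longrightarrow> \<bar>\<phi> y - \<phi> x\<bar> \<le> e"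
    and s: "0 < s"
  shows "\<bar>(LINT y:Omega|lborel. G0 x y s * \<phi> y) - \<phi> x\<bar>
    \<le> e + 3 * M * (2 powr (DIM('a \<times> real) / 2) * (8 * s / r\<^sup>2))"
proof -
  let ?N = "DIM('a \<times> real)"
  define c where "c = 2 powr (?N / 2) * (8 * s / r\<^sup>2)"
  have c: "0 \<le> c" using s by (simp add: c_def)
  have M0: "0 \<le> M" using M[of undefined] by linarith
  have e0: "0 \<le> e" using e[of x] r by simp
  have r_le: "r \<le> norm (x - y)" if "y \<notin> Omega" for y
  proof (rule ccontr)
    assume "\<not> r \<le> norm (x - y)"
    then have "y \<in> ball x r" by (simp add: dist_norm)
    with r(2) that show False by auto
  qed
  have refl_notin: "refl y \<notin> Omega" if "y \<in> Omega" for y :: "'a \<times> real"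
    using that by (auto simp: Omega_def refl_def)
  let ?g = "\<lambda>z y. Gam ?N (norm (z - y))"
  define F where "F y = indicator Omega y * (G0 x y s * \<phi> y) - ?g x y s * \<phi> x" for y
  have F_le: "\<bar>F y\<bar> \<le> e * ?g x y s + 2 * M * c * ?g x y (2 * s) + M * c * ?g (refl x) y (2 * s)" for y
  proof -
    have far: "?g x y s \<le> c * ?g x y (2 * s)" if "r \<le> norm (x - y)"
      unfolding c_def by (rule Gam_tail_le[OF s r(1)]) (use that in simp)
    show ?thesis
    proof (cases "y \<in> Omega")
      case True
      have "r \<le> norm (refl x - y)" using r_le[OF refl_notin[OF True]] by (simp add: norm_diff_refl)
      then have 1: "?g (refl x) y s \<le> c * ?g (refl x) y (2 * s)"
        unfolding c_def by (intro Gam_tail_le[OF s r(1)]) simp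
      have "F y = ?g x y s * (\<phi> y - \<phi> x) - ?g (refl x) y s * \<phi> y"
        using True by (simp add: F_def G0_def norm_diff_refl algebra_simps)
      then have "\<bar>F y\<bar> \<le> ?g x y s * \<bar>\<phi> y - \<phi> x\<bar> + ?g (refl x) y s * \<bar>\<phi> y\<bar>"
        using abs_triangle_ineq4[of "?g x y s * (\<phi> y - \<phi> x)" "?g (refl x) y s * \<phi> y"] by (simp add: abs_mult)
      moreover have "?g (refl x) y s * \<bar>\<phi> y\<bar> \<le> c * ?g (refl x) y (2 * s) * M"
        by (intro mult_mono 1 M mult_nonneg_nonneg c) auto
      moreover have "?g x y s * \<bar>\<phi> y - \<phi> x\<bar> \<le> e * ?g x y s + 2 * M * c * ?g x y (2 * s)"
      proof (cases "y \<in> ball x r")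
        case True
        then have "?g x y s * \<bar>\<phi> y - \<phi> x\<bar> \<le> ?g x y s * e" by (intro mult_left_mono e) auto
        moreover have "0 \<le> 2 * M * c * ?g x y (2 * s)" using M0 c by auto
        ultimately show ?thesis by (simp only: mult.commute[of e])
      next
        case False
        then have "?g x y s * \<bar>\<phi> y - \<phi> x\<bar> \<le> c * ?g x y (2 * s) * (2 * M)"
          using M[of x] M[of y] c
          by (intro mult_mono far) (auto simp: dist_norm abs_le_iff)
        moreover have "0 \<le> e * ?g x y s" using e0 by auto
        ultimately show ?thesis by (simp add: mult_ac)
      qed
      ultimately show ?thesis by (simp add: mult_ac)
    next
      case False
      have "\<bar>F y\<bar> = ?g x y s * \<bar>\<phi> x\<bar>" using False by (simp add: F_def abs_mult)
      also have "\<dots> \<le> c * ?g x y (2 * s) * (2 * M)"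
        using M[of x] M0 c by (intro mult_mono far r_le False) auto
      also have "\<dots> \<le> e * ?g x y s + 2 * M * c * ?g x y (2 * s) + M * c * ?g (refl x) y (2 * s)"
        using e0 M0 c by (simp add: mult_ac)
      finally show ?thesis .
    qed
  qed
  have int: "integrable lborel (\<lambda>y. ?g z y s')" "(\<integral>y. ?g z y s' \<partial>lborel) = 1"
    if "0 < s'" for z :: "'a \<times> real" and s'
    using integrable_Gam[OF that, of z] integral_Gam[OF that, of z] by auto
  have iG: "integrable lborel (\<lambda>y. indicator Omega y * (G0 x y s * \<phi> y))"
    using integrable_G0_Omega[where x = x, OF _ M s] by (simp add: set_integrable_def)
  have iF: "integrable lborel F"
    unfolding F_def by (intro Bochner_Integration.integrable_diff iG integrable_mult_left int(1) s)
  have "(LINT y:Omega|lborel. G0 x y s * \<phi> y) - \<phi> x = (\<integral>y. F y \<partial>lborel)"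
    unfolding F_def using iG int[OF s, of x] by (simp add: set_lebesgue_integral_def)
  also have "\<bar>\<dots>\<bar> \<le> (\<integral>y. \<bar>F y\<bar> \<partial>lborel)" by (rule integral_abs_bound)
  also have "\<dots> \<le> (\<integral>y. e * ?g x y s + 2 * M * c * ?g x y (2 * s) + M * c * ?g (refl x) y (2 * s) \<partial>lborel)"
    using int[OF s] int[of "2 * s"] s iF
    by (intro integral_mono F_le) (auto intro!: Bochner_Integration.integrable_add integrable_mult_right)
  also have "\<dots> = e + 2 * M * c + M * c"
    using int[OF s] int[of "2 * s"] s by simp
  finally show ?thesis by (simp add: c_def algebra_simps)
qed

lemma uniform_modulus_on_compact:
  fixes \<phi> :: "'b::metric_space \<Rightarrow> 'c::metric_space"
  assumes "continuous_on A \<phi>" "open A" "compact K" "K \<subseteq> A" "0 < e"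
  obtains r where "0 < r" "\<And>x y. x \<in> K \<Longrightarrow> y \<in> ball x r \<Longrightarrow> y \<in> A \<and> dist (\<phi> y) (\<phi> x) \<le> e"
proof -
  have "\<exists>d. 0 < d \<and> (\<forall>y\<in>ball x (2 * d). y \<in> A \<and> dist (\<phi> y) (\<phi> x) < e / 2)" if "x \<in> K" for x
  proof -
    have "x \<in> A" using that assms by auto
    then have "isCont \<phi> x" using assms by (simp add: continuous_on_eq_continuous_at)
    then obtain d1 where d1: "0 < d1" "\<And>y. dist y x < d1 \<Longrightarrow> dist (\<phi> y) (\<phi> x) < e / 2"
      unfolding continuous_at_eps_delta using assms(5) by (metis half_gt_zero)
    obtain d2 where d2: "0 < d2" "ball x d2 \<subseteq> A"
      using \<open>x \<in> A\<close> assms(2) by (meson openE)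
    show ?thesis
      by (rule exI[of _ "min d1 d2 / 2"]) (use d1 d2 in \<open>auto simp: dist_commute subset_iff\<close>)
  qed
  then obtain d where d: "\<And>x. x \<in> K \<Longrightarrow> 0 < d x"
    "\<And>x y. x \<in> K \<Longrightarrow> y \<in> ball x (2 * d x) \<Longrightarrow> y \<in> A \<and> dist (\<phi> y) (\<phi> x) < e / 2" by metis
  have "K \<subseteq> (\<Union>x\<in>K. ball x (d x))" using d by force
  then obtain C where C: "C \<subseteq> K" "finite C" "K \<subseteq> (\<Union>x\<in>C. ball x (d x))"
    by (rule compactE_image[OF assms(3), rotated]) auto
  define r where "r = Min (insert 1 (d ` C))"
  have r: "0 < r" "\<And>z. z \<in> C \<Longrightarrow> r \<le> d z" using C d by (auto simp: r_def Min_gr_iff subset_iff)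
  have "y \<in> A \<and> dist (\<phi> y) (\<phi> x) \<le> e" if xy: "x \<in> K" "y \<in> ball x r" for x y
  proof -
    obtain z where z: "z \<in> C" "dist z x < d z" using C(3) xy(1) by auto
    have "dist x y < d z" using xy(2) r(2)[OF z(1)] by simp
    then have "dist z y < 2 * d z" using z dist_triangle[of z y x] by linarith
    moreover have "z \<in> K" "dist z x < 2 * d z" using z C d[of z] by auto
    ultimately have "y \<in> A" "dist (\<phi> y) (\<phi> z) < e / 2" "dist (\<phi> x) (\<phi> z) < e / 2"
      using d(2)[of z] by auto
    then show ?thesis using dist_triangle2[of "\<phi> y" "\<phi> x" "\<phi> z"] by linarith
  qed
  with r(1) that show ?thesis by blast
qed

lemma w_dir_minus_phi:
  fixes x :: "'a::euclidean_space \<times> real" and \<phi> :: "'a \<times> real \<Rightarrow> real"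
  assumes [measurable]: "\<phi> \<in> borel_measurable borel" "\<psi> \<in> borel_measurable borel"
    and M: "\<And>y. \<bar>\<phi> y\<bar> \<le> M" "\<And>y. \<bar>\<psi> y\<bar> \<le> M"
    and r: "0 < r" "ball x r \<subseteq> Omega" and e: "\<And>y. y \<in> ball x r \<Longrightarrow> \<bar>\<phi> y - \<phi> x\<bar> \<le> e"
    and pos: "0 < \<epsilon>" and t: "0 < t" "t < T"
  shows "\<bar>w_dir \<epsilon> \<phi> \<psi> x t - \<phi> x\<bar> \<le> e + 3 * M * (2 powr (DIM('a \<times> real) / 2) * (8 * (T / \<epsilon>) / r\<^sup>2))
    + 2 / \<epsilon> * (M * (256 / r ^ 4 * (T / \<epsilon>)) * T)"
proof -
  have M0: "0 \<le> M" using M(1)[of undefined] by linarith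
  have r_le: "r \<le> snd x"
  proof (rule ccontr)
    assume less: "\<not> r \<le> snd x"
    have "x \<in> Omega" using r by auto
    then have "snd x > 0" by (auto simp: Omega_def)
    with less have "(fst x, 0) \<in> ball x r" by (simp add: dist_prod_def dist_real_def)
    with r(2) show False by (auto simp: Omega_def)
  qed
  define F where "F \<tau> = indicator {0<..<t} \<tau> *
        (heat \<psi> (fst x) ((t - \<tau>) / \<epsilon>) * dGam1 (snd x) ((t - \<tau>) / \<epsilon>))" for \<tau>
  have [measurable]: "F \<in> borel_measurable borel" unfolding F_def by measurable
  have F: "\<bar>\<integral>\<tau>. F \<tau> \<partial>lborel\<bar> \<le> (M * (256 / r ^ 4 * (T / \<epsilon>))) * t"
  proof (rule abs_integral_bounded_interval)
    fix \<tau> assume \<tau>: "0 < \<tau>" "\<tau> < t"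
    have "\<bar>dGam1 (snd x) ((t - \<tau>) / \<epsilon>)\<bar> \<le> 256 / r ^ 4 * ((t - \<tau>) / \<epsilon>)"
      using \<tau> r r_le pos by (intro abs_dGam1_le) auto
    also have "\<dots> \<le> 256 / r ^ 4 * (T / \<epsilon>)"
      using \<tau> t r pos by (intro mult_left_mono divide_right_mono) auto
    finally have D: "\<bar>dGam1 (snd x) ((t - \<tau>) / \<epsilon>)\<bar> \<le> 256 / r ^ 4 * (T / \<epsilon>)" .
    have "\<bar>F \<tau>\<bar> = \<bar>heat \<psi> (fst x) ((t - \<tau>) / \<epsilon>)\<bar> * \<bar>dGam1 (snd x) ((t - \<tau>) / \<epsilon>)\<bar>"
      using \<tau> by (simp add: F_def abs_mult)
    also have "\<dots> \<le> M * (256 / r ^ 4 * (T / \<epsilon>))"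
      by (intro mult_mono D abs_heat_le M M0) (use \<tau> pos in auto)
    finally show "\<bar>F \<tau>\<bar> \<le> M * (256 / r ^ 4 * (T / \<epsilon>))" .
  qed (use M0 r pos t in \<open>auto simp: F_def\<close>)
  also have "\<dots> \<le> (M * (256 / r ^ 4 * (T / \<epsilon>))) * T"
    using M0 r pos t by (intro mult_left_mono) auto
  finally have 2: "2 / \<epsilon> * \<bar>\<integral>\<tau>. F \<tau> \<partial>lborel\<bar> \<le> 2 / \<epsilon> * (M * (256 / r ^ 4 * (T / \<epsilon>)) * T)"
    using pos by (intro mult_left_mono) auto
  have "\<bar>(LINT y:Omega|lborel. G0 x y (t / \<epsilon>) * \<phi> y) - \<phi> x\<bar>
      \<le> e + 3 * M * (2 powr (DIM('a \<times> real) / 2) * (8 * (t / \<epsilon>) / r\<^sup>2))"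
    using pos t by (intro G0_approximates_identity M r e) auto
  also have "\<dots> \<le> e + 3 * M * (2 powr (DIM('a \<times> real) / 2) * (8 * (T / \<epsilon>) / r\<^sup>2))"
    using pos t M0 by (intro add_left_mono mult_left_mono divide_right_mono) auto
  finally have 1: "\<bar>(LINT y:Omega|lborel. G0 x y (t / \<epsilon>) * \<phi> y) - \<phi> x\<bar>
      \<le> e + 3 * M * (2 powr (DIM('a \<times> real) / 2) * (8 * (T / \<epsilon>) / r\<^sup>2))" .
  have w: "w_dir \<epsilon> \<phi> \<psi> x t - \<phi> x = ((LINT y:Omega|lborel. G0 x y (t / \<epsilon>) * \<phi> y) - \<phi> x)
      - 2 / \<epsilon> * (\<integral>\<tau>. F \<tau> \<partial>lborel)"
    using t by (simp add: w_dir_eq F_def)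
  have "\<bar>w_dir \<epsilon> \<phi> \<psi> x t - \<phi> x\<bar> \<le> \<bar>(LINT y:Omega|lborel. G0 x y (t / \<epsilon>) * \<phi> y) - \<phi> x\<bar>
      + \<bar>2 / \<epsilon> * (\<integral>\<tau>. F \<tau> \<partial>lborel)\<bar>"
    unfolding w by (rule abs_triangle_ineq4)
  also have "\<bar>2 / \<epsilon> * (\<integral>\<tau>. F \<tau> \<partial>lborel)\<bar> = 2 / \<epsilon> * \<bar>\<integral>\<tau>. F \<tau> \<partial>lborel\<bar>"
    using pos by (simp add: abs_mult)
  finally show ?thesis using 1 2 by (rule order_trans[OF _ add_mono])
qed

lemma borel_measurable_Hk [measurable]:
  fixes x :: "'a::euclidean_space \<times> real"
  assumes "0 \<le> t" and [measurable]: "f \<in> borel_measurable M" "g \<in> borel_measurable M"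
  shows "(\<lambda>y. Hk \<epsilon> \<kappa> \<delta> x (f y, g y) t) \<in> borel_measurable M"
  unfolding Hk_eq[OF assms(1)] fst_conv snd_conv by measurable

lemma
  fixes x :: "'a::euclidean_space \<times> real"
  assumes [measurable]: "\<phi> \<in> borel_measurable borel" "\<phi>' \<in> borel_measurable borel"
      "\<psi> \<in> borel_measurable borel" "\<psi>' \<in> borel_measurable borel"
    and phi: "AE y in lborel. y \<in> Omega \<longrightarrow> \<phi> y = \<phi>' y" and psi: "AE y in lborel. \<psi> y = \<psi>' y"
  shows u_dyn_cong_AE: "0 \<le> t \<Longrightarrow> u_dyn \<epsilon> \<kappa> \<delta> \<phi> \<psi> x t = u_dyn \<epsilon> \<kappa> \<delta> \<phi>' \<psi>' x t"
    and w_dir_cong_AE: "w_dir \<epsilon> \<phi> \<psi> x t = w_dir \<epsilon> \<phi>' \<psi>' x t"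
    and U_harm_cong_AE: "U_harm \<psi> x = U_harm \<psi>' x"
proof -
  have [measurable]: "fst \<in> borel \<rightarrow>\<^sub>M (borel :: 'a measure)" "snd \<in> borel \<rightarrow>\<^sub>M (borel :: real measure)"
    by (auto intro!: borel_measurable_continuous_onI continuous_intros)
  have interior: "(LINT y:Omega|lborel. k y * \<phi> y) = (LINT y:Omega|lborel. k y * \<phi>' y)"
    if "k \<in> borel_measurable borel" for k
    using that phi by (intro set_lebesgue_integral_cong_AE) (auto elim!: eventually_mono)
  have boundary: "(\<integral>y. k y * \<psi> y \<partial>lborel) = (\<integral>y. k y * \<psi>' y \<partial>lborel)"
    if "k \<in> borel_measurable borel" for k
    using that psi by (intro integral_cong_AE) (auto elim!: eventually_mono)
  have Gk: "(\<lambda>y. Gk \<epsilon> \<kappa> \<delta> x y t) \<in> borel_measurable borel" if "0 \<le> t"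
    using borel_measurable_Hk[OF that, of fst borel snd \<epsilon> \<kappa> \<delta> x] unfolding Gk_def by simp
  have Pair: "(\<lambda>y'. (y', 0 :: real)) \<in> borel \<rightarrow>\<^sub>M (borel :: ('a \<times> real) measure)"
    by (intro borel_measurable_continuous_onI continuous_intros)
  show "u_dyn \<epsilon> \<kappa> \<delta> \<phi> \<psi> x t = u_dyn \<epsilon> \<kappa> \<delta> \<phi>' \<psi>' x t" if "0 \<le> t"
    unfolding u_dyn_def interior[OF Gk[OF that]]
      boundary[OF measurable_compose[OF Pair Gk[OF that]]] ..
  have "(\<integral>y'. Gam DIM('a) (norm (fst x - y')) s * c * \<psi> y' \<partial>lborel)
      = (\<integral>y'. Gam DIM('a) (norm (fst x - y')) s * c * \<psi>' y' \<partial>lborel)" for s c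
    by (rule boundary) measurable
  then show "w_dir \<epsilon> \<phi> \<psi> x t = w_dir \<epsilon> \<phi>' \<psi>' x t"
    unfolding w_dir_def interior[OF borel_measurable_G0] by simp
  have "(\<lambda>y. Pker (fst x - y) (snd x)) \<in> borel_measurable borel"
    unfolding Pker_def Let_def norm_Pair by measurable
  from boundary[OF this] show "U_harm \<psi> x = U_harm \<psi>' x"
    unfolding U_harm_def .
qed

theorem theorem5p3:
  fixes \<phi> :: "'a::euclidean_space \<times> real \<Rightarrow> real" and \<psi> :: "'a \<Rightarrow> real"
  assumes phi_meas: "\<phi> \<in> borel_measurable lborel"
    and phi_bdd: "\<exists>M. AE y in lborel. y \<in> Omega \<longrightarrow> \<bar>\<phi> y\<bar> \<le> M"
    and psi_meas: "\<psi> \<in> borel_measurable lborel"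
    and psi_bdd: "\<exists>M. AE y' in lborel. \<bar>\<psi> y'\<bar> \<le> M"
  shows
   "(\<forall>\<epsilon>>0. \<forall>k>0. \<forall>L>0. \<forall>T>0.
       (\<exists>C. \<forall>\<^sub>F \<delta> in at_top. \<forall>x\<in>Omega_Lc L. \<forall>t\<in>{0<..<T}.
            \<bar>u_dyn \<epsilon> k \<delta> \<phi> \<psi> x t - w_dir \<epsilon> \<phi> \<psi> x t\<bar> \<le> C / \<delta>)
     \<and> (\<exists>C. \<forall>\<^sub>F \<delta> in at_top. \<forall>x\<in>Omega_Lc L. \<forall>t\<in>{0<..<T}.
            \<bar>u_dyn \<epsilon> 0 \<delta> \<phi> \<psi> x t - w_dir \<epsilon> \<phi> \<psi> x t\<bar> \<le> C / \<delta>))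
    \<and> (\<forall>L>0. \<forall>T>0. \<exists>C. \<forall>\<^sub>F \<epsilon> in at_right 0. \<forall>x\<in>Omega_L L. \<forall>t\<in>{T..}.
            \<bar>w_dir \<epsilon> \<phi> \<psi> x t - U_harm \<psi> x\<bar> \<le> C * sqrt \<epsilon>)
    \<and> ((continuous_on Omega \<phi> \<and> bounded (\<phi> ` Omega)) \<longrightarrow>
        (\<forall>K T. compact K \<and> K \<subseteq> Omega \<and> T > 0 \<longrightarrow>
           (\<forall>e>0. \<forall>\<^sub>F \<epsilon> in at_top. \<forall>x\<in>K. \<forall>t\<in>{0<..<T}.
               \<bar>w_dir \<epsilon> \<phi> \<psi> x t - \<phi> x\<bar> \<le> e)))"
proof -
  obtain M1 M2 where M1: "AE y in lborel. y \<in> Omega \<longrightarrow> \<bar>\<phi> y\<bar> \<le> M1"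
    and M2: "AE y in lborel. \<bar>\<psi> y\<bar> \<le> M2"
    using phi_bdd psi_bdd by blast
  have [measurable]: "\<phi> \<in> borel_measurable borel" "\<psi> \<in> borel_measurable borel"
    using phi_meas psi_meas by simp_all
  define M where "M = max 0 (max M1 M2)"
  have M: "0 \<le> M" "M1 \<le> M" "M2 \<le> M" by (auto simp: M_def)
  define \<phi>' where "\<phi>' y = (if y \<in> Omega \<and> \<bar>\<phi> y\<bar> \<le> M then \<phi> y else 0)" for y
  define \<psi>' where "\<psi>' y = (if \<bar>\<psi> y\<bar> \<le> M then \<psi> y else 0)" for y
  have meas' [measurable]: "\<phi>' \<in> borel_measurable borel" "\<psi>' \<in> borel_measurable borel"
    unfolding \<phi>'_def \<psi>'_def by measurable
  have bdd': "\<bar>\<phi>' y\<bar> \<le> M" "\<bar>\<psi>' y'\<bar> \<le> M" for y y'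
    using M by (auto simp: \<phi>'_def \<psi>'_def)
  have phi': "AE y in lborel. y \<in> Omega \<longrightarrow> \<phi> y = \<phi>' y"
    using M1 by eventually_elim (use M in \<open>auto simp: \<phi>'_def\<close>)
  have psi': "AE y in lborel. \<psi> y = \<psi>' y"
    using M2 by eventually_elim (use M in \<open>auto simp: \<psi>'_def\<close>)
  have u: "u_dyn \<epsilon> \<kappa> \<delta> \<phi> \<psi> x t = u_dyn \<epsilon> \<kappa> \<delta> \<phi>' \<psi>' x t" if "0 \<le> t" for \<epsilon> \<kappa> \<delta> x t
    by (rule u_dyn_cong_AE[OF _ _ _ _ phi' psi' that]) measurable
  have w: "w_dir \<epsilon> \<phi> \<psi> x t = w_dir \<epsilon> \<phi>' \<psi>' x t" for \<epsilon> x t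
    by (rule w_dir_cong_AE[OF _ _ _ _ phi' psi']) measurable
  have U: "U_harm \<psi> x = U_harm \<psi>' x" for x :: "'a \<times> real"
    by (rule U_harm_cong_AE[OF _ _ _ _ phi' psi']) measurable
  have dyn: "\<exists>C. \<forall>\<^sub>F \<delta> in at_top. \<forall>x\<in>Omega_Lc L. \<forall>t\<in>{0<..<T}.
      \<bar>u_dyn \<epsilon> \<kappa> \<delta> \<phi> \<psi> x t - w_dir \<epsilon> \<phi> \<psi> x t\<bar> \<le> C / \<delta>"
    if pos: "0 < \<epsilon>" "0 \<le> \<kappa>" "0 < L" "0 < T" for \<epsilon> \<kappa> L T
  proof -
    obtain C where "\<forall>\<delta>>0. \<forall>x\<in>Omega_Lc L. \<forall>t\<in>{0<..<T}.
        \<bar>u_dyn \<epsilon> \<kappa> \<delta> \<phi>' \<psi>' x t - w_dir \<epsilon> \<phi>' \<psi>' x t\<bar> \<le> C / \<delta>"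
      using u_dyn_minus_w_dir[OF meas' bdd' pos] by blast
    then show ?thesis
      by (intro exI[of _ C] eventually_mono[OF eventually_gt_at_top[of 0]]) (simp add: u w)
  qed
  have harm: "\<exists>C. \<forall>\<^sub>F \<epsilon> in at_right 0. \<forall>x\<in>Omega_L L. \<forall>t\<in>{T..}.
      \<bar>w_dir \<epsilon> \<phi> \<psi> x t - U_harm \<psi> x\<bar> \<le> C * sqrt \<epsilon>" if "0 < T" for L T
  proof (intro exI[of _ "4 * M * L / sqrt T"] eventually_mono[OF eventually_at_right_less[of 0]] ballI)
    fix \<epsilon> :: real and x :: "'a \<times> real" and t assume "0 < \<epsilon>" "x \<in> Omega_L L" "t \<in> {T..}"
    then show "\<bar>w_dir \<epsilon> \<phi> \<psi> x t - U_harm \<psi> x\<bar> \<le> 4 * M * L / sqrt T * sqrt \<epsilon>"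
      unfolding w U using that by (intro w_dir_minus_U_harm bdd' meas'(2)) auto
  qed
  have init: "\<forall>\<^sub>F \<epsilon> in at_top. \<forall>x\<in>K. \<forall>t\<in>{0<..<T}. \<bar>w_dir \<epsilon> \<phi> \<psi> x t - \<phi> x\<bar> \<le> e"
    if cont: "continuous_on Omega \<phi>" and bdd: "bounded (\<phi> ` Omega)"
      and K: "compact K" "K \<subseteq> Omega" and T: "0 < T" and e: "0 < e" for K T e
  proof -
    obtain B where B: "\<And>y. y \<in> Omega \<Longrightarrow> \<bar>\<phi> y\<bar> \<le> B"
      using bdd by (auto simp: bounded_iff)
    define m where "m = max M B"
    define \<phi>2 where "\<phi>2 y = indicator Omega y * \<phi> y" for y
    have phi2: "\<bar>\<phi>2 y\<bar> \<le> m" for y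
      using M B[of y] by (auto simp: \<phi>2_def m_def indicator_def)
    have psi2: "\<bar>\<psi>' y\<bar> \<le> m" for y using bdd'(2)[of y] by (simp add: m_def)
    have phi2_meas [measurable]: "\<phi>2 \<in> borel_measurable borel" unfolding \<phi>2_def by measurable
    have w2: "w_dir \<epsilon> \<phi> \<psi> x t = w_dir \<epsilon> \<phi>2 \<psi>' x t" for \<epsilon> x t
      by (rule w_dir_cong_AE[OF _ _ _ _ _ psi']) (auto simp: \<phi>2_def)
    have "open (Omega :: ('a \<times> real) set)" unfolding Omega_def by (intro open_Times) auto
    then obtain r where r: "0 < r"
      "\<And>x y. x \<in> K \<Longrightarrow> y \<in> ball x r \<Longrightarrow> y \<in> Omega \<and> dist (\<phi> y) (\<phi> x) \<le> e / 2"
      using uniform_modulus_on_compact[OF cont _ K, of "e / 2"] e by auto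
    let ?R = "\<lambda>\<epsilon>. e / 2 + 3 * m * (2 powr (DIM('a \<times> real) / 2) * (8 * (T / \<epsilon>) / r\<^sup>2))
        + 2 / \<epsilon> * (m * (256 / r ^ 4 * (T / \<epsilon>)) * T)"
    have le: "\<bar>w_dir \<epsilon> \<phi> \<psi> x t - \<phi> x\<bar> \<le> ?R \<epsilon>"
      if "0 < \<epsilon>" and x: "x \<in> K" and t: "t \<in> {0<..<T}" for \<epsilon> x t
    proof -
      have \<phi>2: "\<phi>2 y = \<phi> y" if "y \<in> Omega" for y using that by (simp add: \<phi>2_def)
      have "\<bar>w_dir \<epsilon> \<phi>2 \<psi>' x t - \<phi>2 x\<bar> \<le> ?R \<epsilon>"
      proof (rule w_dir_minus_phi[OF phi2_meas meas'(2) phi2 psi2 r(1)])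
        show "ball x r \<subseteq> Omega" using r(2)[OF x] by blast
        show "\<bar>\<phi>2 y - \<phi>2 x\<bar> \<le> e / 2" if "y \<in> ball x r" for y
          using r(2)[OF x that] K(2) x by (auto simp: \<phi>2 dist_real_def)
      qed (use that in auto)
      then show ?thesis using K(2) x by (auto simp: w2 \<phi>2)
    qed
    have inv: "((\<lambda>\<epsilon>. c / \<epsilon>) \<longlongrightarrow> 0) at_top" for c :: real
      by (rule tendsto_divide_0[OF tendsto_const]) (rule filterlim_at_top_imp_at_infinity[OF filterlim_ident])
    have "(?R \<longlongrightarrow> e / 2 + 3 * m * (2 powr (DIM('a \<times> real) / 2) * (8 * 0 / r\<^sup>2))
        + 0 * (m * (256 / r ^ 4 * 0) * T)) at_top"
      using r(1) by (intro tendsto_add tendsto_mult tendsto_divide[where b = "r\<^sup>2"] inv tendsto_const) auto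
    then have "\<forall>\<^sub>F \<epsilon> in at_top. ?R \<epsilon> < e"
      by (rule order_tendstoD(2)) (use e in simp)
    then show ?thesis
      using eventually_gt_at_top[of 0] by eventually_elim (auto intro: order_trans[OF le])
  qed
  show ?thesis using dyn harm init by (auto simp: less_imp_le)
qed

end
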